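(* Let $\Phi_1,\Phi_2,\Phi_3$ be Young functions such that $$\Phi_1^{-1}(x)\,\Phi_2^{-1}(x)\le\Phi_3^{-1}(x),\qquad x\ge0.$$ If $(\alpha,\beta)\in\mathbb R^2$ and $m(\xi,\eta)=\hat\mu(\alpha\xi+\beta\eta)$, where $\mu$ is a (finite) regular Borel measure on $\mathbb R$, then $m\in\mathcal{BM}_{(\Phi_1,\Phi_2,\Phi_3)}(\mathbb R)$ and $\|m\|_{(\Phi_1,\Phi_2,\Phi_3)}\le 2\|\mu\|_1$, where $\|\mu\|_1$ is the total variation of $\mu$.
   Context: A Young function is a function $\Phi:\mathbb R\to[0,\infty]$, not identically zero, which is convex, even and satisfies $\Phi(0)=0$. For $y\ge 0$, $\Phi^{-1}(y)=\inf\{x>0:\Phi(x)>y\}$ (with $\inf\emptyset=\infty$). The Orlicz space $L^\Phi(\mathbb R)$ consists of the measurable $f:\mathbb R\to\mathbb C$ (modulo a.e. equality) with $\int_{\mathbb R}\Phi(|f(x)|/\lambda)\,dx<\infty$ for some $\lambda>0$, with the Luxemburg norm $N_\Phi(f)=\inf\{\lambda>0:\int_{\mathbb R}\Phi(|f(x)|/\lambda)\,dx\le 1\}$. The Fourier transform is $\hat f(\xi)=\int_{\mathbb R}f(x)e^{-2\pi i x\xi}\,dx$ for functions and $\hat\mu(\xi)=\int_{\mathbb R}e^{-2\pi i x\xi}\,d\mu(x)$ for measures, and $\mathcal P(\mathbb R)$ is the set of $f\in L^1(\mathbb R)$ such that $\operatorname{supp}\hat f$ is compact. $\mathcal{BM}_{(\Phi_1,\Phi_2,\Phi_3)}(\mathbb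 R)$ is the space of locally integrable functions $m:\mathbb R^2\to\mathbb C$ for which there is a constant $C>0$ such that $$B_m(f,g)(x)=\int_{\mathbb R}\int_{\mathbb R}\hat f(\xi)\hat g(\eta)m(\xi,\eta)e^{2\pi i(\xi+\eta)x}\,d\xi\,d\eta$$ satisfies $N_{\Phi_3}(B_m(f,g))\le C\,N_{\Phi_1}(f)N_{\Phi_2}(g)$ for all $f,g\in\mathcal P(\mathbb R)$; $\|m\|_{(\Phi_1,\Phi_2,\Phi_3)}$ is the infimum of such constants $C$. *)

theory Defs
  imports "HOL-Analysis.Analysis"
begin

section \<open>Young functions and the Luxemburg norm\<close>

definition young_function :: "(real \<Rightarrow> ennreal) \<Rightarrow> bool" where
  "young_function \<Phi> \<longleftrightarrow>
     (\<exists>x. \<Phi> x \<noteq> 0) \<and>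
     (\<forall>x y t. 0 \<le> t \<and> t \<le> 1 \<longrightarrow>
        \<Phi> ((1 - t) * x + t * y) \<le> ennreal (1 - t) * \<Phi> x + ennreal t * \<Phi> y) \<and>
     (\<forall>x. \<Phi> (- x) = \<Phi> x) \<and>
     \<Phi> 0 = 0"

definition young_inverse :: "(real \<Rightarrow> ennreal) \<Rightarrow> real \<Rightarrow> ennreal" where
  "young_inverse \<Phi> y = Inf {ennreal x | x. x > 0 \<and> \<Phi> x > ennreal y}"

text \<open>The norm takes the value \<open>\<infinity>\<close> exactly on the measurable functions outside the Orlicz space.\<close>

definition luxemburg_norm :: "(real \<Rightarrow> ennreal) \<Rightarrow> (real \<Rightarrow> complex) \<Rightarrow> ennreal" where
  "luxemburg_norm \<Phi> f =
     Inf {ennreal l | l. l > 0 \<and> (\<integral>\<^sup>+ x. \<Phi> (cmod (f x) / l) \<partial>lebesgue) \<le> 1}"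

section \<open>Fourier transform of functions and bilinear multipliers\<close>

definition fourier :: "(real \<Rightarrow> complex) \<Rightarrow> real \<Rightarrow> complex" where
  "fourier f \<xi> = (LINT x|lebesgue. f x * cis (- 2 * pi * x * \<xi>))"

definition band_limited :: "(real \<Rightarrow> complex) set" where
  "band_limited = {f. integrable lebesgue f \<and> compact (closure {\<xi>. fourier f \<xi> \<noteq> 0})}"

definition bilinear_op ::
  "(real \<times> real \<Rightarrow> complex) \<Rightarrow> (real \<Rightarrow> complex) \<Rightarrow> (real \<Rightarrow> complex) \<Rightarrow> real \<Rightarrow> complex" where
  "bilinear_op m f g x =
     (LINT \<eta>|lebesgue. LINT \<xi>|lebesgue.
        fourier f \<xi> * fourier g \<eta> * m (\<xi>, \<eta>) * cis (2 * pi * (\<xi> + \<eta>) * x))"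

definition bm_bound ::
  "(real \<Rightarrow> ennreal) \<Rightarrow> (real \<Rightarrow> ennreal) \<Rightarrow> (real \<Rightarrow> ennreal) \<Rightarrow>
   (real \<times> real \<Rightarrow> complex) \<Rightarrow> real \<Rightarrow> bool" where
  "bm_bound \<Phi>1 \<Phi>2 \<Phi>3 m C \<longleftrightarrow>
     (\<forall>f\<in>band_limited. \<forall>g\<in>band_limited.
        luxemburg_norm \<Phi>3 (bilinear_op m f g)
          \<le> ennreal C * luxemburg_norm \<Phi>1 f * luxemburg_norm \<Phi>2 g)"

definition BM ::
  "(real \<Rightarrow> ennreal) \<Rightarrow> (real \<Rightarrow> ennreal) \<Rightarrow> (real \<Rightarrow> ennreal) \<Rightarrow> (real \<times> real \<Rightarrow> complex) set" where
  "BM \<Phi>1 \<Phi>2 \<Phi>3 =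
     {m. (\<forall>K. compact K \<longrightarrow> m absolutely_integrable_on K) \<and>
         (\<exists>C>0. bm_bound \<Phi>1 \<Phi>2 \<Phi>3 m C)}"

definition bm_norm ::
  "(real \<Rightarrow> ennreal) \<Rightarrow> (real \<Rightarrow> ennreal) \<Rightarrow> (real \<Rightarrow> ennreal) \<Rightarrow>
   (real \<times> real \<Rightarrow> complex) \<Rightarrow> ennreal" where
  "bm_norm \<Phi>1 \<Phi>2 \<Phi>3 m = Inf {ennreal C | C. C > 0 \<and> bm_bound \<Phi>1 \<Phi>2 \<Phi>3 m C}"

section \<open>Complex Borel measures on the real line\<close>

text \<open>A complex measure is a countably additive set function on the Borel sets; its values on
  other sets are irrelevant.  A finite positive measure \<open>M\<close> is the special case
  \<open>\<lambda>E. complex_of_real (measure M E)\<close>.\<close>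

definition complex_measure :: "(real set \<Rightarrow> complex) \<Rightarrow> bool" where
  "complex_measure \<mu> \<longleftrightarrow>
     (\<forall>A :: nat \<Rightarrow> real set. range A \<subseteq> sets borel \<and> disjoint_family A \<longrightarrow>
        (\<lambda>n. \<mu> (A n)) sums \<mu> (\<Union>n. A n))"

definition variation :: "(real set \<Rightarrow> complex) \<Rightarrow> real set \<Rightarrow> ennreal" where
  "variation \<mu> E =
     (SUP A \<in> {A :: nat \<Rightarrow> real set.
                 range A \<subseteq> sets borel \<and> disjoint_family A \<and> (\<Union>n. A n) = E}.
        \<Sum>n. ennreal (cmod (\<mu> (A n))))"

definition finite_regular_borel_measure :: "(real set \<Rightarrow> complex) \<Rightarrow> bool" where
  "finite_regular_borel_measure \<mu> \<longleftrightarrow>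
     complex_measure \<mu> \<and> variation \<mu> UNIV < \<infinity> \<and>
     (\<forall>E\<in>sets borel.
        variation \<mu> E = (INF U \<in> {U. open U \<and> E \<subseteq> U}. variation \<mu> U) \<and>
        variation \<mu> E = (SUP K \<in> {K. compact K \<and> K \<subseteq> E}. variation \<mu> K))"

text \<open>The positive part in the Jordan decomposition of a real-valued measure \<open>\<nu>\<close>, namely
  \<open>E \<mapsto> sup {\<nu>(F) | F \<subseteq> E Borel}\<close>.  \<open>ennreal\<close> truncates at \<open>0\<close>, which does not change
  the supremum because \<open>F = {}\<close> is admissible.  The negative part of \<open>\<nu>\<close> is the positive part
  of \<open>- \<nu>\<close>.\<close>

definition positive_part :: "(real set \<Rightarrow> real) \<Rightarrow> real measure" where
  "positive_part \<nu> =
     measure_of UNIV (sets borel) (\<lambda>E. SUP F \<in> {F \<in> sets borel. F \<subseteq> E}. ennreal (\<nu> F))"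

definition signed_integral :: "(real set \<Rightarrow> real) \<Rightarrow> (real \<Rightarrow> complex) \<Rightarrow> complex" where
  "signed_integral \<nu> f =
     integral\<^sup>L (positive_part \<nu>) f - integral\<^sup>L (positive_part (\<lambda>E. - \<nu> E)) f"

definition complex_measure_integral :: "(real set \<Rightarrow> complex) \<Rightarrow> (real \<Rightarrow> complex) \<Rightarrow> complex" where
  "complex_measure_integral \<mu> f =
     signed_integral (\<lambda>E. Re (\<mu> E)) f + \<i> * signed_integral (\<lambda>E. Im (\<mu> E)) f"

definition fourier_measure :: "(real set \<Rightarrow> complex) \<Rightarrow> real \<Rightarrow> complex" where
  "fourier_measure \<mu> \<xi> = complex_measure_integral \<mu> (\<lambda>x. cis (- 2 * pi * x * \<xi>))"

end

theory Submission
  imports Defs "HOL-Probability.Probability"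
begin

text \<open>Since \<open>m (\<xi>, \<eta>) = \<integral> cis (- 2 \<pi> t (\<alpha> \<xi> + \<beta> \<eta>)) d\<mu>(t)\<close>, the operator with symbol \<open>m\<close> is, by
  Fubini, a superposition of products of translates,
  \<open>B f g x = \<integral> P (x - \<alpha> t) * Q (x - \<beta> t) d\<mu>(t)\<close>, where \<open>P\<close> and \<open>Q\<close> are the inverse Fourier transforms
  of the Fourier transforms of \<open>f\<close> and \<open>g\<close> (lemma \<open>bilinear_op_superposition\<close>).  Three facts turn this
  identity into the norm bound.

  The hypothesis on the inverses gives, up to a factor \<open>\<theta> < 1\<close> that is removed at the end,
  \<open>\<Phi>3 (s * t) \<le> \<Phi>1 s + \<Phi>2 t\<close> (lemma \<open>young_product\<close>).  Hence a product of two functions of norm at most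
  one has \<open>\<Phi>3\<close>-modular at most two, and convexity trades the modular two for the factor two in
  the norm.  Jensen's inequality for \<open>\<Phi>3\<close> (lemma \<open>young_jensen\<close>) and translation invariance of Lebesgue
  measure pass this bound through the integral over \<open>t\<close> at the price of the total mass
  (lemma \<open>young_integral_superposition\<close>).

  To have the total variation of \<open>\<mu>\<close> as that mass, \<open>\<mu>\<close> is written as \<open>u\<close> times a positive measure
  with \<open>cmod u \<le> 1\<close> and total mass at most the total variation (lemma \<open>complex_measure_polar\<close>).  This comes from
  the Jordan decompositions of the real and imaginary parts and the Radon-Nikodym theorem.

  Finally \<open>P\<close> and \<open>Q\<close> have to be compared with \<open>f\<close> and \<open>g\<close>.  The inversion theorem
  would give \<open>P = f\<close> almost everywhere, but the inequality between the modulars suffices, and it is cheaper: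
  the Gaussian means of \<open>f\<close> converge to \<open>P\<close> pointwise, they do not increase the modular by Jensen's
  inequality, and Fatou's lemma passes to the limit (lemma \<open>young_integral_inverse_fourier_le\<close>).

  A Young function may jump to \<open>\<infinity>\<close> at the end of the interval where it is finite, and
  its value there is arbitrary, so it need not be lower semicontinuous.  This is why the modular
  inequalities below compare \<open>\<Phi> (x / l')\<close> with \<open>\<Phi> (x / l)\<close> for \<open>l < l'\<close> strictly.  The loss disappears
  in the infimum that defines the Luxemburg norm.\<close>

section \<open>Young functions\<close>

lemma young_convex:
  assumes "young_function \<Phi>" "0 \<le> t" "t \<le> 1"
  shows "\<Phi> ((1 - t) * x + t * y) \<le> ennreal (1 - t) * \<Phi> x + ennreal t * \<Phi> y"
  using assms unfolding young_function_def by blast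

lemma young_zero: "young_function \<Phi> \<Longrightarrow> \<Phi> 0 = 0"
  unfolding young_function_def by blast

lemma young_even: "young_function \<Phi> \<Longrightarrow> \<Phi> \<bar>x\<bar> = \<Phi> x"
  unfolding young_function_def by (cases "x \<ge> 0") auto

lemma young_scale:
  assumes "young_function \<Phi>" "0 \<le> t" "t \<le> 1"
  shows "\<Phi> (t * x) \<le> ennreal t * \<Phi> x"
  using young_convex[OF assms, of 0 x] young_zero[OF assms(1)] by simp

lemma young_mono:
  assumes "young_function \<Phi>" "0 \<le> x" "x \<le> y"
  shows "\<Phi> x \<le> \<Phi> y"
proof (cases "x = 0")
  case True
  then show ?thesis using young_zero[OF assms(1)] by simp
next
  case False
  then have y: "y > 0" "x / y \<le> 1" using assms by auto
  have "\<Phi> (x / y * y) \<le> ennreal (x / y) * \<Phi> y"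
    using assms y by (intro young_scale) auto
  also have "\<dots> \<le> 1 * \<Phi> y"
    using y by (intro mult_right_mono) (auto simp: ennreal_le_1)
  finally show ?thesis using y by simp
qed

text \<open>Convexity makes the sublevel sets intervals.\<close>

lemma young_measurable:
  assumes "young_function \<Phi>"
  shows "\<Phi> \<in> borel_measurable borel"
proof (rule borel_measurableI_le)
  fix a :: ennreal
  have "is_interval {x. \<Phi> x \<le> a}"
    unfolding is_interval_1
  proof safe
    fix p q x assume *: "\<Phi> p \<le> a" "\<Phi> q \<le> a" "p \<le> x" "x \<le> q"
    then have "\<bar>x\<bar> \<le> \<bar>p\<bar> \<or> \<bar>x\<bar> \<le> \<bar>q\<bar>" by linarith
    then show "\<Phi> x \<le> a"
      using young_mono[OF assms, of "\<bar>x\<bar>" "\<bar>p\<bar>"] young_mono[OF assms, of "\<bar>x\<bar>" "\<bar>q\<bar>"] *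
      by (auto simp: young_even[OF assms])
  qed
  then show "{x \<in> space borel. \<Phi> x \<le> a} \<in> sets borel"
    using real_interval_borel_measurable by simp
qed

text \<open>A supporting line of \<open>\<Phi>\<close> at \<open>s\<close>, written as \<open>u \<mapsto> c u - d\<close> with \<open>d\<close> on the other side because
  subtraction in \<open>ennreal\<close> truncates.  The slope is nonnegative by monotonicity, and \<open>d\<close> by
  \<open>\<Phi> 0 = 0\<close>.  The point \<open>v\<close> puts \<open>s\<close> into the interior of the domain of finiteness, without which
  there may be no such line.\<close>

lemma young_affine_minorant:
  assumes Y: "young_function \<Phi>" and s: "0 \<le> s" "s < v" and v: "\<Phi> v < \<infinity>"
  obtains c d where "0 \<le> c" "0 \<le> d" "ennreal (c * s) = \<Phi> s + ennreal d"
    "\<And>u. 0 \<le> u \<Longrightarrow> ennreal (c * u) \<le> \<Phi> u + ennreal d"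
proof -
  define I where "I = {x. \<Phi> x < \<infinity>}"
  define p where "p x = enn2real (\<Phi> x)" for x
  have p: "\<Phi> x = ennreal (p x)" if "x \<in> I" for x
    using that by (simp add: I_def p_def)
  have I0: "x \<in> I" if "\<bar>x\<bar> \<le> v" for x
    using young_mono[OF Y, of "\<bar>x\<bar>" v] that v unfolding I_def by (auto simp: young_even[OF Y])
  have cI: "\<Phi> ((1 - t) * x + t * y) \<le> ennreal ((1 - t) * p x + t * p y)"
    if "x \<in> I" "y \<in> I" "0 \<le> t" "t \<le> 1" for t x y
    using young_convex[OF Y that(3,4), of x y] that(3,4) enn2real_nonneg
    unfolding p[OF that(1)] p[OF that(2)]
    by (simp add: ennreal_mult[symmetric] ennreal_plus[symmetric] p_def del: ennreal_plus)
  have conv: "convex I"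
    unfolding convex_alt using cI
    by (auto simp: I_def) (metis ennreal_less_top infinity_ennreal_def le_less_trans)
  have cvx: "convex_on I p"
  proof (rule convex_onI[OF _ conv])
    fix t x y :: real assume *: "0 < t" "t < 1" "x \<in> I" "y \<in> I"
    then have "(1 - t) * x + t * y \<in> I"
      using conv unfolding convex_alt by auto
    then have "ennreal (p ((1 - t) * x + t * y)) \<le> ennreal ((1 - t) * p x + t * p y)"
      using cI[of x y t] * p by auto
    then show "p ((1 - t) *\<^sub>R x + t *\<^sub>R y) \<le> (1 - t) * p x + t * p y"
      using * by (subst (asm) ennreal_le_iff) (auto simp: p_def)
  qed
  have int: "s \<in> interior I"
    using s I0 by (intro interiorI[of "{-v<..<v}"]) auto
  define c where "c = Inf ((\<lambda>t. (p s - p t) / (s - t)) ` ({s<..} \<inter> I))"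
  have line: "p s + c * (u - s) \<le> p u" if "u \<in> I" for u
    unfolding c_def by (rule convex_le_Inf_differential[OF cvx int that])
  have c: "0 \<le> c" unfolding c_def
  proof (rule cInf_greatest)
    show "(\<lambda>t. (p s - p t) / (s - t)) ` ({s<..} \<inter> I) \<noteq> {}" using s I0[of v] by auto
    fix z assume "z \<in> (\<lambda>t. (p s - p t) / (s - t)) ` ({s<..} \<inter> I)"
    then obtain t where t: "t > s" "t \<in> I" "z = (p s - p t) / (s - t)" by auto
    have "p s \<le> p t"
      using young_mono[OF Y, of s t] t s unfolding p_def I_def by (auto intro!: enn2real_mono)
    then show "0 \<le> z" using t by (auto simp: divide_nonpos_nonpos)
  qed
  have p0: "p 0 = 0" using young_zero[OF Y] by (simp add: p_def)
  have d: "0 \<le> c * s - p s" using line[of 0] I0[of 0] s p0 by simp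
  have pn: "0 \<le> p x" for x by (simp add: p_def)
  show ?thesis
  proof (rule that[OF c d])
    show "ennreal (c * s) = \<Phi> s + ennreal (c * s - p s)"
      using I0[of s] s d pn by (subst p) (auto simp: ennreal_plus[symmetric] simp del: ennreal_plus)
    show "ennreal (c * u) \<le> \<Phi> u + ennreal (c * s - p s)" if "0 \<le> u" for u
    proof (cases "u \<in> I")
      case True
      have "c * u \<le> p u + (c * s - p s)" using line[OF True] by (simp add: algebra_simps)
      then show ?thesis
        using True d pn by (simp add: p ennreal_plus[symmetric] del: ennreal_plus)
    next
      case False
      then show ?thesis by (simp add: I_def less_top[symmetric])
    qed
  qed
qed

text \<open>Jensen's inequality with the total mass of the measure bounded by \<open>V\<close> instead of equal to it, which
  \<open>\<Phi> 0 = 0\<close> permits.  The strict inequality in the hypothesis replaces lower semicontinuity: when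
  \<open>\<Phi>\<close> is infinite on the right of \<open>s\<close>, it forces \<open>h > s\<close> on a set of positive measure, so that the
  right-hand side is infinite.  Otherwise the inequality is the integral of an affine minorant.\<close>

lemma young_jensen:
  assumes Y: "young_function \<Phi>" and s: "0 \<le> s" and V: "0 \<le> V" "emeasure \<rho> (space \<rho>) \<le> ennreal V"
    and h[measurable]: "h \<in> borel_measurable \<rho>" "\<And>x. 0 \<le> h x"
    and less: "ennreal (s * V) < (\<integral>\<^sup>+x. ennreal (h x) \<partial>\<rho>)"
  shows "ennreal V * \<Phi> s \<le> (\<integral>\<^sup>+x. \<Phi> (h x) \<partial>\<rho>)"
proof -
  note [measurable] = young_measurable[OF Y]
  show ?thesis
  proof (cases "\<exists>v>s. \<Phi> v < \<infinity>")
    case True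
    then obtain v where "s < v" "\<Phi> v < \<infinity>" by auto
    then obtain c d where cd: "0 \<le> c" "0 \<le> d" "ennreal (c * s) = \<Phi> s + ennreal d"
      "\<And>u. 0 \<le> u \<Longrightarrow> ennreal (c * u) \<le> \<Phi> u + ennreal d"
      using young_affine_minorant[OF Y s] by metis
    have "ennreal V * \<Phi> s + ennreal V * ennreal d = ennreal V * ennreal (c * s)"
      by (simp only: cd(3) distrib_left)
    also have "\<dots> = ennreal c * ennreal (s * V)"
      using cd(1) s V(1) by (simp add: ennreal_mult[symmetric] mult_ac)
    also have "\<dots> \<le> ennreal c * (\<integral>\<^sup>+x. ennreal (h x) \<partial>\<rho>)"
      using less by (intro mult_left_mono) auto
    also have "\<dots> = (\<integral>\<^sup>+x. ennreal (c * h x) \<partial>\<rho>)"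
      using cd by (subst nn_integral_cmult[symmetric]) (auto simp: ennreal_mult h)
    also have "\<dots> \<le> (\<integral>\<^sup>+x. \<Phi> (h x) + ennreal d \<partial>\<rho>)"
      by (intro nn_integral_mono cd h)
    also have "\<dots> = (\<integral>\<^sup>+x. \<Phi> (h x) \<partial>\<rho>) + ennreal d * emeasure \<rho> (space \<rho>)"
      by (subst nn_integral_add) auto
    also have "\<dots> \<le> (\<integral>\<^sup>+x. \<Phi> (h x) \<partial>\<rho>) + ennreal V * ennreal d"
      by (intro add_left_mono) (use mult_right_mono[OF V(2), of "ennreal d"] in \<open>simp add: mult.commute\<close>)
    finally show ?thesis
      using V cd by (simp add: ennreal_mult[symmetric] ennreal_add_left_cancel_le add.commute)
  next
    case False
    then have inf: "\<Phi> v = \<infinity>" if "v > s" for v using that by (simp add: less_top[symmetric])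
    have "\<not> (AE x in \<rho>. h x \<le> s)"
    proof
      assume "AE x in \<rho>. h x \<le> s"
      then have "(\<integral>\<^sup>+x. ennreal (h x) \<partial>\<rho>) \<le> (\<integral>\<^sup>+x. ennreal s \<partial>\<rho>)"
        by (intro nn_integral_mono_AE) (auto simp: ennreal_leI)
      also have "\<dots> = ennreal s * emeasure \<rho> (space \<rho>)" by simp
      also have "\<dots> \<le> ennreal (s * V)"
        using V s by (auto simp: ennreal_mult intro!: mult_left_mono)
      finally show False using less by simp
    qed
    then have nz: "emeasure \<rho> {x \<in> space \<rho>. s < h x} \<noteq> 0"
      by (subst (asm) AE_iff_measurable[of "{x \<in> space \<rho>. s < h x}"]) auto
    have "\<infinity> = \<infinity> * emeasure \<rho> {x \<in> space \<rho>. s < h x}"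
      using nz by (simp add: ennreal_top_mult)
    also have "\<dots> = (\<integral>\<^sup>+x. \<infinity> * indicator {x \<in> space \<rho>. s < h x} x \<partial>\<rho>)"
      by (subst nn_integral_cmult_indicator) auto
    also have "\<dots> \<le> (\<integral>\<^sup>+x. \<Phi> (h x) \<partial>\<rho>)"
      by (intro nn_integral_mono) (auto simp: inf split: split_indicator)
    finally show ?thesis by (simp add: top.extremum_unique)
  qed
qed

lemma young_inverse_ge:
  assumes "young_function \<Phi>" "0 \<le> s" "\<Phi> s \<le> ennreal y"
  shows "ennreal s \<le> young_inverse \<Phi> y"
  unfolding young_inverse_def
proof (rule Inf_greatest, safe)
  fix x assume "x > 0" "ennreal y < \<Phi> x"
  then have "\<Phi> s < \<Phi> x" using assms by order
  then have "s \<le> x" using young_mono[OF assms(1), of x s] \<open>x > 0\<close> by force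
  then show "ennreal s \<le> ennreal x" by (rule ennreal_leI)
qed

lemma young_le_of_less_inverse:
  assumes "0 < s" "ennreal s < young_inverse \<Phi> y"
  shows "\<Phi> s \<le> ennreal y"
proof (rule ccontr)
  assume "\<not> \<Phi> s \<le> ennreal y"
  then have "young_inverse \<Phi> y \<le> ennreal s"
    unfolding young_inverse_def using assms(1) by (intro Inf_lower) auto
  then show False using assms(2) by simp
qed

text \<open>With \<open>y\<close> the larger of \<open>\<Phi>1 s\<close> and \<open>\<Phi>2 t\<close>, both \<open>s\<close> and \<open>t\<close> lie below the inverses at \<open>y\<close>, hence
  \<open>s * t\<close> lies below the inverse of \<open>\<Phi>3\<close> at \<open>y\<close>.  Only strictly below that inverse is \<open>\<Phi>3\<close> known to
  be at most \<open>y\<close>, and \<open>\<theta>\<close> moves the argument there.\<close>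

lemma young_product:
  assumes Y: "young_function \<Phi>1" "young_function \<Phi>2" "young_function \<Phi>3"
    and inv: "\<And>x::real. x \<ge> 0 \<Longrightarrow> young_inverse \<Phi>1 x * young_inverse \<Phi>2 x \<le> young_inverse \<Phi>3 x"
    and st: "0 \<le> s" "0 \<le> t" and \<theta>: "0 < \<theta>" "\<theta> < 1"
  shows "\<Phi>3 (\<theta> * (s * t)) \<le> \<Phi>1 s + \<Phi>2 t"
proof (cases "\<Phi>1 s < \<infinity> \<and> \<Phi>2 t < \<infinity> \<and> s * t \<noteq> 0")
  case False
  then consider "\<Phi>1 s = \<infinity>" | "\<Phi>2 t = \<infinity>" | "s * t = 0"
    by (fastforce simp: less_top[symmetric])
  then show ?thesis by cases (auto simp: young_zero[OF Y(3)])
next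
  case True
  then have pos: "0 < s" "0 < t" using st by auto
  define y where "y = max (enn2real (\<Phi>1 s)) (enn2real (\<Phi>2 t))"
  have y0: "0 \<le> y" by (simp add: y_def le_max_iff_disj)
  obtain a b where ab: "\<Phi>1 s = ennreal a" "\<Phi>2 t = ennreal b" "0 \<le> a" "0 \<le> b"
    using True by (metis enn2real_nonneg ennreal_enn2real infinity_ennreal_def)
  have y_eq: "y = max a b" using ab by (simp add: y_def)
  have y: "\<Phi>1 s \<le> ennreal y" "\<Phi>2 t \<le> ennreal y"
    using ab by (auto simp: y_eq intro!: ennreal_leI)
  have le: "ennreal y \<le> \<Phi>1 s + \<Phi>2 t"
    using ab by (auto simp: y_eq max_def)
  have "\<theta> * (s * t) < s * t" using pos \<theta> by simp
  then have "ennreal (\<theta> * (s * t)) < ennreal (s * t)" using pos by (intro ennreal_lessI) auto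
  also have "\<dots> = ennreal s * ennreal t" using st by (simp add: ennreal_mult)
  also have "\<dots> \<le> young_inverse \<Phi>1 y * young_inverse \<Phi>2 y"
    using y pos Y by (intro mult_mono young_inverse_ge) auto
  also have "\<dots> \<le> young_inverse \<Phi>3 y" by (rule inv[OF y0])
  finally have "\<Phi>3 (\<theta> * (s * t)) \<le> ennreal y"
    using pos \<theta> by (intro young_le_of_less_inverse) auto
  then show ?thesis using le by (rule order_trans)
qed

text \<open>Convexity and \<open>\<Phi> 0 = 0\<close> make \<open>\<Phi>\<close> grow at least linearly beyond any point where it does not vanish.\<close>

lemma young_unbounded:
  assumes Y: "young_function \<Phi>"
  obtains a b where "0 < a" "0 < b" "\<And>n::nat. \<And>x. real n * a \<le> \<bar>x\<bar> \<Longrightarrow> of_nat n * b \<le> \<Phi> x"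
proof -
  obtain x0 where x0: "\<Phi> x0 \<noteq> 0" using Y unfolding young_function_def by blast
  show ?thesis
  proof (rule that[of "\<bar>x0\<bar>" "\<Phi> x0"])
    show "0 < \<bar>x0\<bar>" using x0 young_zero[OF Y] by auto
    show "0 < \<Phi> x0" using x0 by (simp add: zero_less_iff_neq_zero)
    fix n :: nat and x assume *: "real n * \<bar>x0\<bar> \<le> \<bar>x\<bar>"
    show "of_nat n * \<Phi> x0 \<le> \<Phi> x"
    proof (cases "n = 0")
      case False
      have "of_nat n * \<Phi> (1 / real n * (real n * \<bar>x0\<bar>))
          \<le> of_nat n * (ennreal (1 / real n) * \<Phi> (real n * \<bar>x0\<bar>))"
        using False by (intro mult_left_mono young_scale[OF Y]) auto
      also have "\<dots> = \<Phi> (real n * \<bar>x0\<bar>)"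
        using False by (simp add: mult.assoc[symmetric] ennreal_of_nat_eq_real_of_nat ennreal_mult[symmetric])
      also have "\<dots> \<le> \<Phi> \<bar>x\<bar>" using * by (intro young_mono[OF Y]) auto
      finally show ?thesis using False by (simp add: young_even[OF Y])
    qed simp
  qed
qed

lemma ennreal_archimedean_mult:
  fixes c :: ennreal
  assumes "c \<noteq> 0"
  shows "\<exists>n::nat. 1 < of_nat n * c"
proof (cases c)
  case (real r)
  then have "r > 0" using assms by (auto simp: less_le)
  then obtain n :: nat where "1 < real n * r" using reals_Archimedean3 by blast
  then show ?thesis using real \<open>r > 0\<close>
    by (intro exI[of _ n]) (simp add: ennreal_of_nat_eq_real_of_nat ennreal_mult[symmetric])
next
  case top
  then show ?thesis by (intro exI[of _ 1]) simp
qed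

text \<open>Chebyshev's inequality on \<open>{x. e \<le> cmod (f x)}\<close>: dividing \<open>f\<close> by ever smaller \<open>l\<close> makes \<open>\<Phi>\<close>
  arbitrarily large there, while the modular stays at most one.  The main bound needs this where one
  norm vanishes and the other is infinite, since \<open>0 * \<infinity> = 0\<close> in \<open>ennreal\<close>.\<close>

lemma luxemburg_norm_zero_imp_AE:
  assumes Y: "young_function \<Phi>" and f[measurable]: "f \<in> borel_measurable lebesgue"
    and 0: "luxemburg_norm \<Phi> f = 0"
  shows "AE x in lebesgue. f x = 0"
proof -
  note [measurable] = young_measurable[OF Y]
  obtain a b where ab: "0 < a" "0 < b" "\<And>n::nat. \<And>x. real n * a \<le> \<bar>x\<bar> \<Longrightarrow> of_nat n * b \<le> \<Phi> x"
    using young_unbounded[OF Y] by metis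
  have "emeasure lebesgue {x. e \<le> cmod (f x)} = 0" if e: "0 < e" for e
  proof (rule ccontr)
    let ?A = "{x. e \<le> cmod (f x)}"
    have A[measurable]: "?A \<in> sets lebesgue"
      using f borel_measurable_iff_halfspace_ge[of "\<lambda>x. cmod (f x)" lebesgue] by simp
    assume "emeasure lebesgue ?A \<noteq> 0"
    then have "b * emeasure lebesgue ?A \<noteq> 0" using ab by auto
    then obtain n where n: "1 < of_nat n * (b * emeasure lebesgue ?A)"
      using ennreal_archimedean_mult by blast
    then have "n > 0" by (cases n) auto
    then have "luxemburg_norm \<Phi> f < ennreal (e / (real n * a))"
      using 0 e ab by simp
    then obtain l where l: "0 < l" "(\<integral>\<^sup>+ x. \<Phi> (cmod (f x) / l) \<partial>lebesgue) \<le> 1"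
        "ennreal l < ennreal (e / (real n * a))"
      unfolding luxemburg_norm_def Inf_less_iff by blast
    then have "l < e / (real n * a)" by (simp add: ennreal_less_iff)
    then have le: "real n * a \<le> e / l" using l ab \<open>n > 0\<close> by (simp add: field_simps)
    have "of_nat n * (b * emeasure lebesgue ?A) = (\<integral>\<^sup>+x. of_nat n * b * indicator ?A x \<partial>lebesgue)"
      by (subst nn_integral_cmult_indicator) (auto simp: mult.assoc)
    also have "\<dots> \<le> (\<integral>\<^sup>+ x. \<Phi> (cmod (f x) / l) \<partial>lebesgue)"
    proof (intro nn_integral_mono)
      fix x
      have "e / l \<le> cmod (f x) / l" if "x \<in> ?A" using that l by (simp add: divide_right_mono)
      then show "of_nat n * b * indicator ?A x \<le> \<Phi> (cmod (f x) / l)"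
        using ab(3)[of n "cmod (f x) / l"] le l by (auto split: split_indicator)
    qed
    finally show False using n l by simp
  qed
  then have "AE x in lebesgue. \<not> inverse (real (Suc n)) \<le> cmod (f x)" for n
    using f borel_measurable_iff_halfspace_ge[of "\<lambda>x. cmod (f x)" lebesgue]
    by (subst AE_iff_measurable[OF _ refl]) (auto simp del: of_nat_Suc)
  then have "AE x in lebesgue. \<forall>n. \<not> inverse (real (Suc n)) \<le> cmod (f x)"
    by (simp add: AE_all_countable)
  then show ?thesis
    by eventually_elim (metis less_imp_le norm_eq_zero reals_Archimedean zero_less_norm_iff)
qed

lemma luxemburg_norm_leI:
  assumes "0 \<le> b" "\<And>l. b < l \<Longrightarrow> (\<integral>\<^sup>+ x. \<Phi> (cmod (f x) / l) \<partial>lebesgue) \<le> 1"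
  shows "luxemburg_norm \<Phi> f \<le> ennreal b"
proof (rule ennreal_le_epsilon)
  fix e :: real assume "0 < e"
  then have "luxemburg_norm \<Phi> f \<le> ennreal (b + e)"
    unfolding luxemburg_norm_def using assms by (intro Inf_lower) (auto intro!: exI[of _ "b + e"])
  then show "luxemburg_norm \<Phi> f \<le> ennreal b + ennreal e"
    using assms \<open>0 < e\<close> by simp
qed

section \<open>Polar decomposition of a complex measure\<close>

locale finite_signed_measure =
  fixes \<nu> :: "real set \<Rightarrow> real" and K :: real
  assumes sums: "\<And>A :: nat \<Rightarrow> real set. range A \<subseteq> sets borel \<Longrightarrow> disjoint_family A \<Longrightarrow>
      (\<lambda>n. \<nu> (A n)) sums \<nu> (\<Union>n. A n)"
    and bound: "\<And>F. F \<in> sets borel \<Longrightarrow> \<bar>\<nu> F\<bar> \<le> K"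
begin

lemma empty: "\<nu> {} = 0"
proof -
  have "(\<lambda>n::nat. \<nu> {}) sums \<nu> (\<Union>n::nat. {})"
    by (intro sums) (auto simp: disjoint_family_on_def)
  then have "(\<lambda>n::nat. \<nu> {}) \<longlonglongrightarrow> 0"
    by (intro summable_LIMSEQ_zero) (auto simp: sums_iff)
  then show ?thesis by (simp add: LIMSEQ_const_iff)
qed

lemma additive:
  assumes "A \<in> sets borel" "B \<in> sets borel" "A \<inter> B = {}"
  shows "\<nu> (A \<union> B) = \<nu> A + \<nu> B"
proof -
  have "(\<lambda>n. \<nu> (binaryset A B n)) sums \<nu> (\<Union>n. binaryset A B n)"
    using assms by (intro sums) (auto simp: range_binaryset_eq disjoint_family_on_def binaryset_def)
  moreover have "(\<lambda>n. \<nu> (binaryset A B n)) sums (\<nu> A + \<nu> B)"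
    using binaryset_sums[of \<nu> A B] empty by simp
  ultimately show ?thesis by (metis UN_binaryset_eq sums_unique2)
qed

lemma uminus: "finite_signed_measure (\<lambda>E. - \<nu> E) K"
  by unfold_locales (use sums bound in \<open>auto intro: sums_minus\<close>)

definition pos :: "real set \<Rightarrow> ennreal" where
  "pos E = (SUP F \<in> {F \<in> sets borel. F \<subseteq> E}. ennreal (\<nu> F))"

lemma pos_upper: "F \<in> sets borel \<Longrightarrow> F \<subseteq> E \<Longrightarrow> ennreal (\<nu> F) \<le> pos E"
  unfolding pos_def by (rule SUP_upper) auto

text \<open>A competitor for \<open>A\<close> and one for \<open>B\<close> unite to one for \<open>A \<union> B\<close>.  Superadditivity gives one half of
  countable additivity; the other half cuts a competitor for the union into pieces.\<close>

lemma pos_superadditive: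
  assumes "A \<inter> B = {}"
  shows "pos A + pos B \<le> pos (A \<union> B)"
proof -
  have *: "ennreal (\<nu> F) + ennreal (\<nu> G) \<le> pos (A \<union> B)"
    if F: "F \<in> sets borel" "F \<subseteq> A" and G: "G \<in> sets borel" "G \<subseteq> B" for F G
  proof -
    consider "\<nu> F \<le> 0" | "\<nu> G \<le> 0" | "\<nu> F \<ge> 0" "\<nu> G \<ge> 0" by linarith
    then show ?thesis
    proof cases
      case 1 then show ?thesis using pos_upper[of G "A \<union> B"] G by (auto simp: ennreal_neg)
    next
      case 2 then show ?thesis using pos_upper[of F "A \<union> B"] F by (auto simp: ennreal_neg)
    next
      case 3
      have "F \<inter> G = {}" using F G assms by auto
      then have "ennreal (\<nu> F) + ennreal (\<nu> G) = ennreal (\<nu> (F \<union> G))"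
        using 3 F G additive by simp
      then show ?thesis using pos_upper[of "F \<union> G" "A \<union> B"] F G by auto
    qed
  qed
  have ne: "{F \<in> sets borel. F \<subseteq> E} \<noteq> {}" for E :: "real set" by auto
  have "pos A + pos B = (SUP F \<in> {F \<in> sets borel. F \<subseteq> A}. ennreal (\<nu> F) + pos B)"
    unfolding pos_def[of A] using ne by (rule ennreal_SUP_add_left[symmetric])
  also have "\<dots> \<le> pos (A \<union> B)"
  proof (rule SUP_least)
    fix F assume F: "F \<in> {F \<in> sets borel. F \<subseteq> A}"
    have "ennreal (\<nu> F) + pos B = (SUP G \<in> {G \<in> sets borel. G \<subseteq> B}. ennreal (\<nu> F) + ennreal (\<nu> G))"
      unfolding pos_def[of B] add.commute[of "ennreal (\<nu> F)"]
      using ne by (rule ennreal_SUP_add_left[symmetric])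
    also have "\<dots> \<le> pos (A \<union> B)" using F * by (intro SUP_least) auto
    finally show "ennreal (\<nu> F) + pos B \<le> pos (A \<union> B)" .
  qed
  finally show ?thesis .
qed

lemma pos_mono: "A \<subseteq> B \<Longrightarrow> pos A \<le> pos B"
  unfolding pos_def by (intro SUP_subset_mono) auto

lemma pos_empty: "pos {} = 0"
proof -
  have "{F \<in> sets borel. F \<subseteq> ({} :: real set)} = {{}}" by auto
  then show ?thesis unfolding pos_def by (simp add: empty)
qed

lemma pos_countably_additive: "countably_additive (sets borel) pos"
proof (rule countably_additiveI)
  fix A :: "nat \<Rightarrow> real set"
  assume A: "range A \<subseteq> sets borel" "disjoint_family A" "(\<Union>i. A i) \<in> sets borel"
  have "(\<Sum>i<n. pos (A i)) \<le> pos (\<Union>i<n. A i)" for n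
  proof (induction n)
    case (Suc n)
    have "(\<Sum>i<Suc n. pos (A i)) \<le> pos (\<Union>i<n. A i) + pos (A n)"
      using Suc by (simp add: add_right_mono)
    also have "\<dots> \<le> pos ((\<Union>i<n. A i) \<union> A n)"
    proof (rule pos_superadditive)
      have "A i \<inter> A n = {}" if "i < n" for i
        using disjoint_family_onD[OF A(2), of i n] that by simp
      then show "(\<Union>i<n. A i) \<inter> A n = {}" by blast
    qed
    also have "(\<Union>i<n. A i) \<union> A n = (\<Union>i<Suc n. A i)" by (auto simp: lessThan_Suc)
    finally show ?case .
  qed (simp add: pos_empty)
  then have "(\<Sum>i<n. pos (A i)) \<le> pos (\<Union>i. A i)" for n
    by (rule order_trans) (auto intro: pos_mono)
  then have "(\<Sum>i. pos (A i)) \<le> pos (\<Union>i. A i)"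
    by (intro suminf_le_const) auto
  moreover have "pos (\<Union>i. A i) \<le> (\<Sum>i. pos (A i))"
    unfolding pos_def[of "\<Union>i. A i"]
  proof (rule SUP_least)
    fix F assume F: "F \<in> {F \<in> sets borel. F \<subseteq> (\<Union>i. A i)}"
    have s: "(\<lambda>i. \<nu> (F \<inter> A i)) sums \<nu> (\<Union>i. F \<inter> A i)"
      using F A by (intro sums) (auto simp: disjoint_family_on_def)
    also have "(\<Union>i. F \<inter> A i) = F" using F by auto
    finally have s: "(\<lambda>i. \<nu> (F \<inter> A i)) sums \<nu> F" .
    have "ennreal (\<Sum>i<n. \<nu> (F \<inter> A i)) \<le> (\<Sum>i. pos (A i))" for n
    proof -
      have "ennreal (\<Sum>i<n. \<nu> (F \<inter> A i)) \<le> ennreal (\<Sum>i<n. max 0 (\<nu> (F \<inter> A i)))"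
        by (intro ennreal_leI sum_mono) auto
      also have "\<dots> = (\<Sum>i<n. ennreal (max 0 (\<nu> (F \<inter> A i))))" by (rule sum_ennreal[symmetric]) simp
      also have "\<dots> \<le> (\<Sum>i<n. pos (A i))"
        using F A(1) by (intro sum_mono) (auto simp: max_def intro!: pos_upper)
      also have "\<dots> \<le> (\<Sum>i. pos (A i))" by (intro sum_le_suminf) auto
      finally show ?thesis .
    qed
    moreover have "(\<lambda>n. ennreal (\<Sum>i<n. \<nu> (F \<inter> A i))) \<longlonglongrightarrow> ennreal (\<nu> F)"
      using s unfolding sums_def by (rule tendsto_ennrealI)
    ultimately show "ennreal (\<nu> F) \<le> (\<Sum>i. pos (A i))"
      by (intro LIMSEQ_le_const2) auto
  qed
  ultimately show "(\<Sum>i. pos (A i)) = pos (\<Union>i. A i)" by (rule antisym)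
qed

lemma sets_positive_part: "sets (positive_part \<nu>) = sets borel"
  unfolding positive_part_def using sets.sigma_sets_eq[of "borel :: real measure"] by simp

lemma emeasure_positive_part:
  "E \<in> sets borel \<Longrightarrow> emeasure (positive_part \<nu>) E = pos E"
  unfolding positive_part_def pos_def[symmetric]
  using pos_countably_additive sets.sigma_algebra_axioms[of "borel :: real measure"]
  by (intro emeasure_measure_of_sigma) (auto simp: positive_def pos_empty)

lemma finite_positive_part: "finite_measure (positive_part \<nu>)"
proof
  have "space (positive_part \<nu>) = UNIV"
    using sets_eq_imp_space_eq[OF sets_positive_part] by simp
  moreover have "pos UNIV \<le> ennreal K"
    unfolding pos_def using bound by (intro SUP_least ennreal_leI) (auto intro: order_trans[OF abs_ge_self])
  ultimately show "emeasure (positive_part \<nu>) (space (positive_part \<nu>)) \<noteq> \<infinity>"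
    by (auto simp: emeasure_positive_part top_unique)
qed

lemma measure_positive_part_upper:
  assumes "F \<in> sets borel" "E \<in> sets borel" "F \<subseteq> E"
  shows "\<nu> F \<le> measure (positive_part \<nu>) E"
proof -
  have "ennreal (\<nu> F) \<le> ennreal (measure (positive_part \<nu>) E)"
    using pos_upper[of F E] assms emeasure_positive_part[of E]
      finite_measure.emeasure_eq_measure[OF finite_positive_part, of E] by simp
  then show ?thesis by (simp add: ennreal_le_iff)
qed

lemma measure_positive_part_le:
  assumes E: "E \<in> sets borel" and c: "\<And>F. F \<in> sets borel \<Longrightarrow> F \<subseteq> E \<Longrightarrow> \<nu> F \<le> c"
  shows "measure (positive_part \<nu>) E \<le> c"
proof -
  have "0 \<le> c" using c[of "{}"] empty by simp
  have "ennreal (measure (positive_part \<nu>) E) = pos E"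
    using emeasure_positive_part[OF E]
      finite_measure.emeasure_eq_measure[OF finite_positive_part, of E] by simp
  also have "\<dots> \<le> ennreal c" unfolding pos_def using c by (intro SUP_least ennreal_leI) auto
  finally show ?thesis using \<open>0 \<le> c\<close> by simp
qed

text \<open>For \<open>F \<subseteq> E\<close> one has \<open>\<nu> F = \<nu> E - \<nu> (E - F)\<close>, and the last term is a competitor for the negative part.
  With the same inequality for \<open>- \<nu>\<close> this is the Jordan decomposition, without a Hahn decomposition.\<close>

lemma measure_positive_part_le_negative_part:
  assumes E: "E \<in> sets borel"
  shows "measure (positive_part \<nu>) E \<le> \<nu> E + measure (positive_part (\<lambda>E. - \<nu> E)) E"
proof (rule measure_positive_part_le[OF E])
  interpret m: finite_signed_measure "\<lambda>E. - \<nu> E" K by (rule uminus)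
  fix F assume F: "F \<in> sets borel" "F \<subseteq> E"
  have "\<nu> (F \<union> (E - F)) = \<nu> F + \<nu> (E - F)" using F E by (intro additive) auto
  moreover have "F \<union> (E - F) = E" using F by auto
  moreover have "- \<nu> (E - F) \<le> measure (positive_part (\<lambda>E. - \<nu> E)) E"
    using F E by (intro m.measure_positive_part_upper) auto
  ultimately show "\<nu> F \<le> \<nu> E + measure (positive_part (\<lambda>E. - \<nu> E)) E" by simp
qed

lemma jordan_decomposition:
  assumes E: "E \<in> sets borel"
  shows "measure (positive_part \<nu>) E - measure (positive_part (\<lambda>E. - \<nu> E)) E = \<nu> E"
proof -
  interpret m: finite_signed_measure "\<lambda>E. - \<nu> E" K by (rule uminus)
  show ?thesis
    using measure_positive_part_le_negative_part[OF E] m.measure_positive_part_le_negative_part[OF E]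
    by simp
qed

end

lemma norm_le_variation:
  assumes \<mu>: "complex_measure \<mu>" and F: "F \<in> sets borel"
  shows "ennreal (cmod (\<mu> F)) \<le> variation \<mu> UNIV"
proof -
  define A where "A = binaryset F (- F)"
  have "ennreal (cmod (\<mu> F)) = (\<Sum>n<1. ennreal (cmod (\<mu> (A n))))" by (simp add: A_def binaryset_def)
  also have "\<dots> \<le> (\<Sum>n. ennreal (cmod (\<mu> (A n))))" by (intro sum_le_suminf) auto
  also have "\<dots> \<le> variation \<mu> UNIV"
    unfolding variation_def using F
    by (intro SUP_upper) (auto simp: A_def range_binaryset_eq UN_binaryset_eq disjoint_family_on_def binaryset_def)
  finally show ?thesis .
qed

lemma complex_measure_parts:
  assumes \<mu>: "complex_measure \<mu>" and fin: "variation \<mu> UNIV < \<infinity>"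
  shows "finite_signed_measure (\<lambda>E. Re (\<mu> E)) (enn2real (variation \<mu> UNIV))"
    and "finite_signed_measure (\<lambda>E. Im (\<mu> E)) (enn2real (variation \<mu> UNIV))"
proof -
  have b: "cmod (\<mu> F) \<le> enn2real (variation \<mu> UNIV)" if "F \<in> sets borel" for F
    using enn2real_mono[OF norm_le_variation[OF \<mu> that]] fin by simp
  have s: "(\<lambda>n. \<mu> (A n)) sums \<mu> (\<Union>n. A n)"
    if "range A \<subseteq> sets borel" "disjoint_family A" for A :: "nat \<Rightarrow> real set"
    using \<mu> that unfolding complex_measure_def by blast
  show "finite_signed_measure (\<lambda>E. Re (\<mu> E)) (enn2real (variation \<mu> UNIV))"
    by unfold_locales (auto intro: sums_Re s order_trans[OF abs_Re_le_cmod b])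
  show "finite_signed_measure (\<lambda>E. Im (\<mu> E)) (enn2real (variation \<mu> UNIV))"
    by unfold_locales (auto intro: sums_Im s order_trans[OF abs_Im_le_cmod b])
qed

lemma exists_sum_measure:
  fixes M :: "'i \<Rightarrow> 'a measure"
  assumes I: "finite I" "\<And>i. i \<in> I \<Longrightarrow> sets (M i) = sets B"
  shows "\<exists>\<sigma>. sets \<sigma> = sets B \<and> (\<forall>E\<in>sets B. emeasure \<sigma> E = (\<Sum>i\<in>I. emeasure (M i) E))"
proof -
  define \<sigma> where "\<sigma> = measure_of (space B) (sets B) (\<lambda>E. \<Sum>i\<in>I. emeasure (M i) E)"
  have "sets \<sigma> = sets B" unfolding \<sigma>_def using sets.sigma_sets_eq sets.space_closed by simp
  moreover have "emeasure \<sigma> E = (\<Sum>i\<in>I. emeasure (M i) E)" if "E \<in> sets B" for E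
    unfolding \<sigma>_def
  proof (intro emeasure_measure_of_sigma sets.sigma_algebra_axioms that)
    show "positive (sets B) (\<lambda>E. \<Sum>i\<in>I. emeasure (M i) E)" by (auto simp: positive_def)
    show "countably_additive (sets B) (\<lambda>E. \<Sum>i\<in>I. emeasure (M i) E)"
    proof (rule countably_additiveI)
      fix A :: "nat \<Rightarrow> 'a set" assume A: "range A \<subseteq> sets B" "disjoint_family A"
      have "(\<Sum>n. \<Sum>i\<in>I. emeasure (M i) (A n)) = (\<Sum>i\<in>I. \<Sum>n. emeasure (M i) (A n))"
        by (intro suminf_sum) auto
      also have "\<dots> = (\<Sum>i\<in>I. emeasure (M i) (\<Union>n. A n))"
        using A I by (intro sum.cong suminf_emeasure) auto
      finally show "(\<Sum>n. \<Sum>i\<in>I. emeasure (M i) (A n)) = (\<Sum>i\<in>I. emeasure (M i) (\<Union>n. A n))" .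
    qed
  qed
  ultimately show ?thesis by blast
qed

lemma finite_measure_real_density:
  assumes \<sigma>: "finite_measure \<sigma>" and N: "finite_measure N" "sets N = sets \<sigma>"
    and le: "\<And>E. E \<in> sets \<sigma> \<Longrightarrow> emeasure N E \<le> emeasure \<sigma> E"
  obtains D where "D \<in> borel_measurable \<sigma>" "\<And>x. 0 \<le> D x" "integrable \<sigma> D"
    "N = density \<sigma> (\<lambda>x. ennreal (D x))"
proof -
  interpret \<sigma>: finite_measure \<sigma> by fact
  interpret N: finite_measure N by fact
  have ac: "absolutely_continuous \<sigma> N"
    unfolding absolutely_continuous_def
  proof
    fix E assume "E \<in> null_sets \<sigma>"
    then show "E \<in> null_sets N" using le[of E] N by (auto simp: null_sets_def)
  qed
  obtain D where D: "D \<in> borel_measurable \<sigma>" "AE x in \<sigma>. RN_deriv \<sigma> N x = ennreal (D x)"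
    "\<And>x. 0 \<le> D x"
    using \<sigma>.real_RN_deriv[OF N(1) ac N(2)] by metis
  note [measurable] = D(1)
  have eq: "N = density \<sigma> (\<lambda>x. ennreal (D x))"
  proof -
    have "density \<sigma> (RN_deriv \<sigma> N) = density \<sigma> (\<lambda>x. ennreal (D x))"
      using D(2) by (intro density_cong) auto
    then show ?thesis using \<sigma>.density_RN_deriv[OF ac N(2)] by simp
  qed
  have "(\<integral>\<^sup>+x. ennreal (norm (D x)) \<partial>\<sigma>) = emeasure N (space \<sigma>)"
    unfolding eq by (subst emeasure_density) (auto intro!: nn_integral_cong simp: D(3))
  also have "\<dots> < \<infinity>" by (simp add: less_top[symmetric])
  finally have "integrable \<sigma> D" by (intro integrableI_bounded D(1))
  then show ?thesis using that D eq by blast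
qed

text \<open>All four positive and negative parts have densities with respect to their sum; the density of \<open>\<mu>\<close>
  is the corresponding linear combination.\<close>

lemma complex_measure_density:
  assumes \<mu>: "complex_measure \<mu>" and fin: "variation \<mu> UNIV < \<infinity>"
  obtains \<sigma> k where "finite_measure \<sigma>" "sets \<sigma> = sets borel" "integrable \<sigma> k"
    "\<And>f. f \<in> borel_measurable borel \<Longrightarrow> bounded (range f) \<Longrightarrow>
       complex_measure_integral \<mu> f = (\<integral>x. k x * f x \<partial>\<sigma>)"
    "\<And>E. E \<in> sets borel \<Longrightarrow> \<mu> E = (\<integral>x. k x * indicator E x \<partial>\<sigma>)"
proof -
  define K where "K = enn2real (variation \<mu> UNIV)"
  interpret R: finite_signed_measure "\<lambda>E. Re (\<mu> E)" K
    unfolding K_def by (rule complex_measure_parts[OF \<mu> fin])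
  interpret I: finite_signed_measure "\<lambda>E. Im (\<mu> E)" K
    unfolding K_def by (rule complex_measure_parts[OF \<mu> fin])
  interpret R': finite_signed_measure "\<lambda>E. - Re (\<mu> E)" K by (rule R.uminus)
  interpret I': finite_signed_measure "\<lambda>E. - Im (\<mu> E)" K by (rule I.uminus)
  \<comment> \<open>The four parts are indexed by \<open>i < 4\<close>, so that they share one sum measure and one choice of densities.\<close>
  define M where "M i = (if i = 0 then positive_part (\<lambda>E. Re (\<mu> E))
    else if i = 1 then positive_part (\<lambda>E. - Re (\<mu> E))
    else if i = 2 then positive_part (\<lambda>E. Im (\<mu> E))
    else positive_part (\<lambda>E. - Im (\<mu> E)))" for i :: nat
  have Msets: "sets (M i) = sets borel" for i
    by (simp add: M_def R.sets_positive_part I.sets_positive_part R'.sets_positive_part I'.sets_positive_part)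
  have Mfin: "finite_measure (M i)" for i
    by (simp add: M_def R.finite_positive_part I.finite_positive_part R'.finite_positive_part I'.finite_positive_part)
  obtain \<sigma> where \<sigma>: "sets \<sigma> = sets borel" "\<And>E. E \<in> sets borel \<Longrightarrow> emeasure \<sigma> E = (\<Sum>i<4. emeasure (M i) E)"
    using exists_sum_measure[of "{..<4::nat}" M borel] Msets by auto
  have space: "space \<sigma> = UNIV" using sets_eq_imp_space_eq[OF \<sigma>(1)] by simp
  have \<sigma>fin: "finite_measure \<sigma>"
  proof
    show "emeasure \<sigma> (space \<sigma>) \<noteq> \<infinity>"
      using \<sigma>(2)[of UNIV] finite_measure.emeasure_finite[OF Mfin] by (simp add: space)
  qed
  interpret \<sigma>: finite_measure \<sigma> by (rule \<sigma>fin)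
  have "\<exists>D. D \<in> borel_measurable \<sigma> \<and> (\<forall>x. 0 \<le> D x) \<and> integrable \<sigma> D
      \<and> M i = density \<sigma> (\<lambda>x. ennreal (D x))" if "i < 4" for i
  proof -
    have "emeasure (M i) E \<le> emeasure \<sigma> E" if "E \<in> sets \<sigma>" for E
      using that \<sigma> \<open>i < 4\<close> by (auto intro!: member_le_sum)
    then show ?thesis
      using finite_measure_real_density[OF \<sigma>fin Mfin[of i]] Msets \<sigma>(1) by metis
  qed
  then obtain D where D: "\<And>i. i < 4 \<Longrightarrow> D i \<in> borel_measurable \<sigma>" "\<And>i x. i < 4 \<Longrightarrow> 0 \<le> D i x"
    "\<And>i. i < 4 \<Longrightarrow> integrable \<sigma> (D i)" "\<And>i. i < 4 \<Longrightarrow> M i = density \<sigma> (\<lambda>x. ennreal (D i x))"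
    by metis
  define k where "k x = complex_of_real (D 0 x) - D 1 x + \<i> * (D 2 x - D 3 x)" for x
  have k: "integrable \<sigma> k" unfolding k_def using D(3) by auto
  have int: "complex_measure_integral \<mu> f = (\<integral>x. k x * f x \<partial>\<sigma>)"
    if f: "f \<in> borel_measurable borel" "bounded (range f)" for f
  proof -
    obtain B where B: "\<And>x. cmod (f x) \<le> B" using f(2) by (auto simp: bounded_iff)
    have f'[measurable]: "f \<in> borel_measurable \<sigma>"
      using f(1) measurable_cong_sets[OF \<sigma>(1) refl] by blast
    have i: "integrable \<sigma> (\<lambda>x. D i x *\<^sub>R f x)" if "i < 4" for i
    proof (rule Bochner_Integration.integrable_bound)
      show "integrable \<sigma> (\<lambda>x. D i x * B)" by (rule integrable_mult_left) (rule D(3)[OF that])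
      show "(\<lambda>x. D i x *\<^sub>R f x) \<in> borel_measurable \<sigma>"
        using D(1)[OF that] by measurable
      have "cmod (D i x *\<^sub>R f x) \<le> norm (D i x * B)" for x
      proof -
        have "D i x * cmod (f x) \<le> D i x * B" by (intro mult_left_mono B D(2)[OF that])
        then show ?thesis using D(2)[OF that, of x] by simp
      qed
      then show "AE x in \<sigma>. cmod (D i x *\<^sub>R f x) \<le> norm (D i x * B)" by simp
    qed
    have d: "integral\<^sup>L (M i) f = (\<integral>x. D i x *\<^sub>R f x \<partial>\<sigma>)" if "i < 4" for i
      unfolding D(4)[OF that] using D that by (intro integral_density) auto
    have "complex_measure_integral \<mu> f = (integral\<^sup>L (M 0) f - integral\<^sup>L (M 1) f)
        + \<i> * (integral\<^sup>L (M 2) f - integral\<^sup>L (M 3) f)"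
      by (simp add: complex_measure_integral_def signed_integral_def M_def)
    also have "\<dots> = (\<integral>x. (D 0 x *\<^sub>R f x - D 1 x *\<^sub>R f x) + \<i> * (D 2 x *\<^sub>R f x - D 3 x *\<^sub>R f x) \<partial>\<sigma>)"
      using i by (simp add: d)
    also have "\<dots> = (\<integral>x. k x * f x \<partial>\<sigma>)"
      by (intro Bochner_Integration.integral_cong) (auto simp: k_def scaleR_conv_of_real algebra_simps)
    finally show ?thesis .
  qed
  have "\<mu> E = (\<integral>x. k x * indicator E x \<partial>\<sigma>)" if E: "E \<in> sets borel" for E
  proof -
    have "bounded (range (indicator E :: real \<Rightarrow> complex))"
      by (auto simp: bounded_iff indicator_def intro!: exI[of _ 1])
    then have "(\<integral>x. k x * indicator E x \<partial>\<sigma>) = complex_measure_integral \<mu> (indicator E)"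
      using E by (intro int[symmetric]) auto
    also have "\<dots> = \<mu> E"
    proof -
      have "integral\<^sup>L (M i) (indicator E :: real \<Rightarrow> complex) = measure (M i) E" for i
      proof -
        interpret finite_measure "M i" by (rule Mfin)
        have "integral\<^sup>L (M i) (indicator E :: real \<Rightarrow> complex)
            = (\<integral>x. complex_of_real (indicator E x) \<partial>M i)"
          by (intro Bochner_Integration.integral_cong) (auto split: split_indicator)
        then show ?thesis using E sets_eq_imp_space_eq[OF Msets[of i]] by simp
      qed
      from this[of 0] this[of 1] this[of 2] this[of 3] show ?thesis
        using R.jordan_decomposition[OF E] I.jordan_decomposition[OF E]
        by (simp add: complex_measure_integral_def signed_integral_def M_def of_real_diff[symmetric]
            del: of_real_diff) (simp add: complex_eq_iff)
    qed
    finally show ?thesis by simp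
  qed
  with that \<sigma>fin \<sigma>(1) k int show ?thesis by blast
qed

text \<open>Partition the line into countably many sets on each of which \<open>k\<close> is within \<open>\<epsilon>\<close> of a
  constant \<open>d n\<close>.  On such a set \<open>A n\<close>, the integral of \<open>cmod \<circ> k\<close> and \<open>cmod (\<mu> (A n))\<close> both differ from
  \<open>cmod (d n)\<close> times the measure of \<open>A n\<close> by at most \<open>\<epsilon>\<close> times that measure.  Summing over \<open>n\<close>, the error is
  \<open>2 * \<epsilon>\<close> times the total mass.\<close>

lemma integral_norm_density_le_variation:
  assumes \<sigma>: "finite_measure \<sigma>" "sets \<sigma> = sets borel" and k: "integrable \<sigma> k"
    and \<mu>: "\<And>E. E \<in> sets borel \<Longrightarrow> \<mu> E = (\<integral>x. k x * indicator E x \<partial>\<sigma>)"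
  shows "(\<integral>\<^sup>+x. ennreal (cmod (k x)) \<partial>\<sigma>) \<le> variation \<mu> UNIV"
proof (rule ennreal_le_epsilon)
  interpret finite_measure \<sigma> by fact
  have space: "space \<sigma> = UNIV" using sets_eq_imp_space_eq[OF \<sigma>(2)] by simp
  fix e :: real assume e: "0 < e"
  \<comment> \<open>The summand \<open>1\<close> only avoids a division by zero when \<open>\<sigma>\<close> is the zero measure.\<close>
  define \<epsilon> where "\<epsilon> = e / (2 * (measure \<sigma> UNIV + 1))"
  have m1: "measure \<sigma> UNIV + 1 > 0" by (simp add: add_nonneg_pos)
  have \<epsilon>: "\<epsilon> > 0" "2 * \<epsilon> * measure \<sigma> UNIV \<le> e"
    using e m1 by (auto simp: \<epsilon>_def field_simps)
  note [measurable] = borel_measurable_integrable[OF k]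
  obtain Q :: "complex set" where Q: "countable Q" "\<And>X. open X \<Longrightarrow> X \<noteq> {} \<Longrightarrow> \<exists>d\<in>Q. d \<in> X"
    by (rule countable_dense_setE) blast
  define d where "d = from_nat_into Q"
  have d: "\<exists>n. cmod (z - d n) < \<epsilon>" for z
  proof -
    obtain q where "q \<in> Q" "q \<in> ball z \<epsilon>" using Q(2)[of "ball z \<epsilon>"] \<epsilon> by auto
    then show ?thesis using from_nat_into_surj[OF Q(1)] by (auto simp: d_def dist_norm)
  qed
  define A where "A = disjointed (\<lambda>n. {x \<in> space \<sigma>. cmod (k x - d n) < \<epsilon>})"
  have A: "A n \<in> sets \<sigma>" for n
  proof -
    have "{x \<in> space \<sigma>. cmod (k x - d n) < \<epsilon>} \<in> sets \<sigma>" for n by measurable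
    then show ?thesis unfolding A_def
      using sets.range_disjointed_sets[of "\<lambda>n. {x \<in> space \<sigma>. cmod (k x - d n) < \<epsilon>}" \<sigma>] by blast
  qed
  note [measurable] = A
  have Adisj: "disjoint_family A" unfolding A_def by (rule disjoint_family_disjointed)
  have Acov: "(\<Union>n. A n) = UNIV" unfolding A_def UN_disjointed_eq using d space by auto
  have near: "cmod (k x - d n) < \<epsilon>" if "x \<in> A n" for x n
    using that disjointed_subset unfolding A_def by force
  define \<rho> where "\<rho> = density \<sigma> (\<lambda>x. ennreal (cmod (k x)))"
  have piece: "emeasure \<rho> (A n) \<le> ennreal (cmod (\<mu> (A n))) + ennreal (2 * \<epsilon>) * emeasure \<sigma> (A n)" for n
  proof -
    have ik: "integrable \<sigma> (\<lambda>x. k x * indicator (A n) x)"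
    proof -
      have "(\<lambda>x. k x * indicator (A n) x) = (\<lambda>x. indicator (A n) x *\<^sub>R k x)"
        by (auto split: split_indicator)
      then show ?thesis using integrable_mult_indicator[OF A k] by simp
    qed
    have id: "integrable \<sigma> (\<lambda>x. d n * indicator (A n) x)"
    proof -
      have "(\<lambda>x. d n * indicator (A n) x) = (\<lambda>x. indicator (A n) x *\<^sub>R d n)"
        by (auto split: split_indicator)
      then show ?thesis using integrable_mult_indicator[OF A, of "\<lambda>_. d n"] by simp
    qed
    have "cmod (d n) * measure \<sigma> (A n) = cmod (\<integral>x. d n * indicator (A n) x \<partial>\<sigma>)"
    proof -
      have "(\<integral>x. indicator (A n) x \<partial>\<sigma>) = (\<integral>x. complex_of_real (indicator (A n) x) \<partial>\<sigma>)"
        by (intro Bochner_Integration.integral_cong) (auto split: split_indicator)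
      then show ?thesis using A by (simp add: norm_mult space)
    qed
    also have "\<dots> = cmod (\<mu> (A n) - (\<integral>x. k x * indicator (A n) x - d n * indicator (A n) x \<partial>\<sigma>))"
      using A \<sigma> by (subst Bochner_Integration.integral_diff[OF ik id]) (simp add: \<mu>)
    also have "\<dots> \<le> cmod (\<mu> (A n)) + cmod (\<integral>x. k x * indicator (A n) x - d n * indicator (A n) x \<partial>\<sigma>)"
      by (rule norm_triangle_ineq4)
    also have "cmod (\<integral>x. k x * indicator (A n) x - d n * indicator (A n) x \<partial>\<sigma>) \<le> (\<integral>x. \<epsilon> * indicator (A n) x \<partial>\<sigma>)"
    proof (rule Bochner_Integration.integral_norm_bound_integral)
      show "integrable \<sigma> (\<lambda>x. k x * indicator (A n) x - d n * indicator (A n) x)"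
        by (rule Bochner_Integration.integrable_diff[OF ik id])
      show "integrable \<sigma> (\<lambda>x. \<epsilon> * indicator (A n) x)"
        using A by (simp add: emeasure_eq_measure)
      show "cmod (k x * indicator (A n) x - d n * indicator (A n) x) \<le> \<epsilon> * indicator (A n) x" for x
        using near[of x n] by (auto split: split_indicator intro: less_imp_le)
    qed
    also have "\<dots> = \<epsilon> * measure \<sigma> (A n)" by (simp add: space)
    finally have *: "(cmod (d n) + \<epsilon>) * measure \<sigma> (A n) \<le> cmod (\<mu> (A n)) + 2 * \<epsilon> * measure \<sigma> (A n)"
      by (simp add: algebra_simps)
    have "emeasure \<rho> (A n) = (\<integral>\<^sup>+x. ennreal (cmod (k x)) * indicator (A n) x \<partial>\<sigma>)"
      unfolding \<rho>_def by (rule emeasure_density) auto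
    also have "\<dots> \<le> (\<integral>\<^sup>+x. ennreal (cmod (d n) + \<epsilon>) * indicator (A n) x \<partial>\<sigma>)"
    proof (intro nn_integral_mono)
      fix x
      have "cmod (k x) \<le> cmod (d n) + \<epsilon>" if "x \<in> A n"
        using near[OF that] norm_triangle_ineq2[of "k x" "d n"] by linarith
      then show "ennreal (cmod (k x)) * indicator (A n) x \<le> ennreal (cmod (d n) + \<epsilon>) * indicator (A n) x"
        by (auto split: split_indicator intro: ennreal_leI)
    qed
    also have "\<dots> = ennreal ((cmod (d n) + \<epsilon>) * measure \<sigma> (A n))"
      using \<epsilon> by (subst nn_integral_cmult_indicator) (auto simp: emeasure_eq_measure ennreal_mult simp del: ennreal_plus)
    also have "\<dots> \<le> ennreal (cmod (\<mu> (A n)) + 2 * \<epsilon> * measure \<sigma> (A n))"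
      by (intro ennreal_leI *)
    also have "\<dots> = ennreal (cmod (\<mu> (A n))) + ennreal (2 * \<epsilon>) * emeasure \<sigma> (A n)"
      using \<epsilon> by (subst ennreal_plus) (auto simp: emeasure_eq_measure ennreal_mult)
    finally show ?thesis .
  qed
  have "(\<integral>\<^sup>+x. ennreal (cmod (k x)) \<partial>\<sigma>) = emeasure \<rho> (\<Union>n. A n)"
    unfolding \<rho>_def Acov space[symmetric] by (subst emeasure_density) (auto intro!: nn_integral_cong)
  also have "\<dots> = (\<Sum>n. emeasure \<rho> (A n))"
    using A by (intro suminf_emeasure[OF _ Adisj, symmetric]) (simp add: \<rho>_def image_subset_iff)
  also have "\<dots> \<le> (\<Sum>n. ennreal (cmod (\<mu> (A n))) + ennreal (2 * \<epsilon>) * emeasure \<sigma> (A n))"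
    by (intro suminf_le piece) auto
  also have "\<dots> = (\<Sum>n. ennreal (cmod (\<mu> (A n)))) + ennreal (2 * \<epsilon>) * (\<Sum>n. emeasure \<sigma> (A n))"
    by (subst suminf_add[symmetric]) auto
  also have "(\<Sum>n. emeasure \<sigma> (A n)) = emeasure \<sigma> UNIV"
    using suminf_emeasure[OF _ Adisj, of \<sigma>] A Acov by (simp add: image_subset_iff)
  also have "ennreal (2 * \<epsilon>) * emeasure \<sigma> UNIV = ennreal (2 * \<epsilon> * measure \<sigma> UNIV)"
    using \<epsilon> by (simp add: emeasure_eq_measure ennreal_mult)
  also have "(\<Sum>n. ennreal (cmod (\<mu> (A n)))) + ennreal (2 * \<epsilon> * measure \<sigma> UNIV) \<le> variation \<mu> UNIV + ennreal e"
  proof (intro add_mono ennreal_leI \<epsilon>)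
    show "(\<Sum>n. ennreal (cmod (\<mu> (A n)))) \<le> variation \<mu> UNIV"
      unfolding variation_def using A Adisj Acov \<sigma>(2) by (intro SUP_upper) (simp add: image_subset_iff)
  qed
  finally show "(\<integral>\<^sup>+x. ennreal (cmod (k x)) \<partial>\<sigma>) \<le> variation \<mu> UNIV + ennreal e" .
qed

text \<open>Split the density \<open>k\<close> of the complex measure into its modulus, which goes into \<open>\<rho>\<close>, and its sign \<open>u\<close>.\<close>

lemma complex_measure_polar:
  assumes \<mu>: "complex_measure \<mu>" and fin: "variation \<mu> UNIV < \<infinity>"
  obtains \<rho> u where "finite_measure \<rho>" "sets \<rho> = sets borel"
    "emeasure \<rho> UNIV \<le> variation \<mu> UNIV"
    "u \<in> borel_measurable borel" "\<And>x. cmod (u x) \<le> 1"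
    "\<And>f. f \<in> borel_measurable borel \<Longrightarrow> bounded (range f) \<Longrightarrow>
       complex_measure_integral \<mu> f = (\<integral>x. u x * f x \<partial>\<rho>)"
proof -
  obtain \<sigma> k where \<sigma>: "finite_measure \<sigma>" "sets \<sigma> = sets borel" and k: "integrable \<sigma> k"
    and int: "\<And>f. f \<in> borel_measurable borel \<Longrightarrow> bounded (range f) \<Longrightarrow>
       complex_measure_integral \<mu> f = (\<integral>x. k x * f x \<partial>\<sigma>)"
    and \<mu>k: "\<And>E. E \<in> sets borel \<Longrightarrow> \<mu> E = (\<integral>x. k x * indicator E x \<partial>\<sigma>)"
    using complex_measure_density[OF \<mu> fin] by metis
  have space: "space \<sigma> = UNIV" using sets_eq_imp_space_eq[OF \<sigma>(2)] by simp
  have mb: "borel_measurable \<sigma> = (borel_measurable borel :: (real \<Rightarrow> complex) set)"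
    by (rule measurable_cong_sets[OF \<sigma>(2) refl])
  have km[measurable]: "k \<in> borel_measurable \<sigma>" using k by simp
  define \<rho> where "\<rho> = density \<sigma> (\<lambda>x. ennreal (cmod (k x)))"
  have tot: "emeasure \<rho> UNIV = (\<integral>\<^sup>+x. ennreal (cmod (k x)) \<partial>\<sigma>)"
    unfolding \<rho>_def space[symmetric] by (subst emeasure_density) (auto intro!: nn_integral_cong)
  have le: "emeasure \<rho> UNIV \<le> variation \<mu> UNIV"
    unfolding tot by (rule integral_norm_density_le_variation[OF \<sigma> k \<mu>k])
  show ?thesis
  proof (rule that[of \<rho> "\<lambda>x. sgn (k x)"])
    show "finite_measure \<rho>"
      using le fin by (intro finite_measureI) (auto simp: \<rho>_def space)
    show "sets \<rho> = sets borel" using \<sigma> by (simp add: \<rho>_def)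
    show "(\<lambda>x. sgn (k x)) \<in> borel_measurable borel" unfolding mb[symmetric] sgn_div_norm by measurable
    show "cmod (sgn (k x)) \<le> 1" for x by (simp add: norm_sgn)
    show "complex_measure_integral \<mu> f = (\<integral>x. sgn (k x) * f x \<partial>\<rho>)"
      if f: "f \<in> borel_measurable borel" "bounded (range f)" for f
    proof -
      have [measurable]: "f \<in> borel_measurable \<sigma>" using f mb by simp
      have "(\<integral>x. sgn (k x) * f x \<partial>\<rho>) = (\<integral>x. cmod (k x) *\<^sub>R (sgn (k x) * f x) \<partial>\<sigma>)"
        unfolding \<rho>_def by (intro integral_density) (auto simp: sgn_div_norm)
      also have "\<dots> = (\<integral>x. k x * f x \<partial>\<sigma>)"
      proof (intro Bochner_Integration.integral_cong refl)
        show "cmod (k x) *\<^sub>R (sgn (k x) * f x) = k x * f x" for x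
          by (cases "k x = 0") (auto simp: sgn_div_norm)
      qed
      finally show ?thesis using int[OF f] by simp
    qed
  qed (fact le)
qed

section \<open>Fourier transforms of band-limited functions\<close>

text \<open>The integrability hypothesis of Fubini's theorem in every interchange below, where the kernel
  is an exponential of modulus one.\<close>

lemma integrable_mult_bounded_kernel:
  fixes a :: "'a \<Rightarrow> complex" and b :: "'b \<Rightarrow> complex"
  assumes M: "sigma_finite_measure M1" "sigma_finite_measure M2"
    and a: "integrable M1 a" and b: "integrable M2 b"
    and c[measurable]: "case_prod c \<in> borel_measurable (M1 \<Otimes>\<^sub>M M2)" and c1: "\<And>x y. cmod (c x y) \<le> 1"
  shows "integrable (M1 \<Otimes>\<^sub>M M2) (\<lambda>(x, y). a x * b y * c x y)"
proof -
  interpret pair_sigma_finite M1 M2 using M by (rule pair_sigma_finite.intro)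
  note [measurable] = borel_measurable_integrable[OF a] borel_measurable_integrable[OF b]
  have "integrable (M1 \<Otimes>\<^sub>M M2) (\<lambda>(x, y). a x * b y)"
  proof (rule Fubini_integrable)
    show "(\<lambda>(x, y). a x * b y) \<in> borel_measurable (M1 \<Otimes>\<^sub>M M2)" by measurable
    show "integrable M1 (\<lambda>x. \<integral>y. cmod (case (x, y) of (x, y) \<Rightarrow> a x * b y) \<partial>M2)"
      using a by (simp add: norm_mult)
    show "AE x in M1. integrable M2 (\<lambda>y. case (x, y) of (x, y) \<Rightarrow> a x * b y)"
      using b by simp
  qed
  then show ?thesis
  proof (rule Bochner_Integration.integrable_bound)
    show "(\<lambda>(x, y). a x * b y * c x y) \<in> borel_measurable (M1 \<Otimes>\<^sub>M M2)" by measurable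
    show "AE p in M1 \<Otimes>\<^sub>M M2. cmod (case p of (x, y) \<Rightarrow> a x * b y * c x y) \<le> cmod (case p of (x, y) \<Rightarrow> a x * b y)"
      by (intro AE_I2) (auto simp: norm_mult split: prod.split intro!: mult_left_le c1)
  qed
qed

lemma norm_integral_le_nn_integral:
  fixes f :: "'a \<Rightarrow> complex"
  shows "ennreal (cmod (\<integral>x. f x \<partial>M)) \<le> (\<integral>\<^sup>+x. ennreal (cmod (f x)) \<partial>M)"
  by (cases "integrable M f") (auto simp: integral_norm_bound_ennreal not_integrable_integral_eq)

lemma cis_measurable[measurable]: "cis \<in> borel_measurable borel"
  by (intro borel_measurable_continuous_onI continuous_intros)


text \<open>Fubini's theorem is applied to products of \<open>lborel\<close>, because the product of two completed measures is not the
  completed product; functions measurable for \<open>lebesgue\<close> are therefore replaced by Borel functions.\<close>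

lemma lebesgue_integrable_borel_representative:
  fixes f :: "real \<Rightarrow> complex"
  assumes f: "integrable lebesgue f"
  obtains f' where "f' \<in> borel_measurable borel" "integrable lborel f'" "AE x in lebesgue. f x = f' x"
proof -
  have f_meas: "f \<in> borel_measurable lebesgue" using f by simp
  obtain r where r: "r \<in> borel_measurable lborel" "AE x in lborel. Re (f x) = r x"
    using completion_ex_borel_measurable_real[of "\<lambda>x. Re (f x)" lborel] f_meas by auto
  obtain i where i: "i \<in> borel_measurable lborel" "AE x in lborel. Im (f x) = i x"
    using completion_ex_borel_measurable_real[of "\<lambda>x. Im (f x)" lborel] f_meas by auto
  define f' where "f' x = Complex (r x) (i x)" for x
  have f': "f' \<in> borel_measurable lborel"
    unfolding f'_def Complex_eq using r i by measurable
  have ae: "AE x in lebesgue. f x = f' x"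
    using r(2) i(2) by (intro AE_completion) (auto simp: f'_def complex_eq_iff)
  have "integrable lebesgue f'"
    using f f' ae by (subst integrable_cong_AE[of f' lebesgue f]) (auto simp: measurable_completion)
  then have "integrable lborel f'" using f' integrable_completion by blast
  with f' ae that show ?thesis by simp
qed

lemma fourier_eq_lborel:
  assumes f': "f' \<in> borel_measurable borel" "AE x in lebesgue. f x = f' x" and f: "f \<in> borel_measurable lebesgue"
  shows "fourier f \<xi> = (\<integral>x. f' x * cis (- 2 * pi * x * \<xi>) \<partial>lborel)"
proof -
  have [measurable]: "f' \<in> borel_measurable lborel" using f' by simp
  have m: "(\<lambda>x. f' x * cis (- 2 * pi * x * \<xi>)) \<in> borel_measurable lborel"
    using f'(1) by measurable
  have c: "(\<lambda>x. cis (- 2 * pi * x * \<xi>)) \<in> borel_measurable lebesgue"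
    by (intro measurable_completion) measurable
  have "fourier f \<xi> = (\<integral>x. f' x * cis (- 2 * pi * x * \<xi>) \<partial>lebesgue)"
    unfolding fourier_def
  proof (rule integral_cong_AE)
    show "(\<lambda>x. f x * cis (- 2 * pi * x * \<xi>)) \<in> borel_measurable lebesgue"
      by (rule borel_measurable_times[OF f c])
    show "(\<lambda>x. f' x * cis (- 2 * pi * x * \<xi>)) \<in> borel_measurable lebesgue"
      by (rule measurable_completion[OF m])
    show "AE x in lebesgue. f x * cis (- 2 * pi * x * \<xi>) = f' x * cis (- 2 * pi * x * \<xi>)"
      using f'(2) by eventually_elim simp
  qed
  also have "\<dots> = (\<integral>x. f' x * cis (- 2 * pi * x * \<xi>) \<partial>lborel)"
    by (rule integral_completion[OF m])
  finally show ?thesis .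
qed

lemma fourier_AE_zero:
  assumes "f \<in> borel_measurable lebesgue" "AE x in lebesgue. f x = 0"
  shows "fourier f \<xi> = 0"
  using fourier_eq_lborel[of "\<lambda>_. 0" f] assms by simp

lemma band_limited_fourier_integrable:
  assumes f: "f \<in> band_limited"
  shows "fourier f \<in> borel_measurable borel" "integrable lborel (fourier f)"
proof -
  have fi: "integrable lebesgue f" and K: "compact (closure {\<xi>. fourier f \<xi> \<noteq> 0})"
    using f by (auto simp: band_limited_def)
  obtain f' where f'[measurable]: "f' \<in> borel_measurable borel"
    and int: "integrable lborel f'" and ae: "AE x in lebesgue. f x = f' x"
    using lebesgue_integrable_borel_representative[OF fi] by metis
  have F: "fourier f = (\<lambda>\<xi>. \<integral>x. f' x * cis (- 2 * pi * x * \<xi>) \<partial>lborel)"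
    using fourier_eq_lborel[OF f' ae] fi by auto
  show m: "fourier f \<in> borel_measurable borel"
    unfolding F by (intro lborel.borel_measurable_lebesgue_integral) measurable
  show "integrable lborel (fourier f)"
  proof (rule integrableI_bounded_set)
    show "closure {\<xi>. fourier f \<xi> \<noteq> 0} \<in> sets lborel" by simp
    show "emeasure lborel (closure {\<xi>. fourier f \<xi> \<noteq> 0}) < \<infinity>"
      using emeasure_bounded_finite[OF compact_imp_bounded[OF K]] by simp
    have "cmod (fourier f \<xi>) \<le> (\<integral>x. cmod (f' x) \<partial>lborel)" for \<xi>
      unfolding F using integral_norm_bound[of lborel "\<lambda>x. f' x * cis (- 2 * pi * x * \<xi>)"]
      by (simp add: norm_mult)
    then show "AE \<xi> in lborel. \<xi> \<in> closure {\<xi>. fourier f \<xi> \<noteq> 0} \<longrightarrow> cmod (fourier f \<xi>) \<le> (\<integral>x. cmod (f' x) \<partial>lborel)"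
      by auto
    show "AE \<xi> in lborel. \<xi> \<notin> closure {\<xi>. fourier f \<xi> \<noteq> 0} \<longrightarrow> fourier f \<xi> = 0"
      using closure_subset[of "{\<xi>. fourier f \<xi> \<noteq> 0}"] by auto
    show "fourier f \<in> borel_measurable lborel" using m by simp
  qed
qed

definition inverse_fourier :: "(real \<Rightarrow> complex) \<Rightarrow> real \<Rightarrow> complex" where
  "inverse_fourier F x = (\<integral>\<xi>. F \<xi> * cis (2 * pi * \<xi> * x) \<partial>lborel)"

lemma inverse_fourier_measurable[measurable]:
  assumes [measurable]: "F \<in> borel_measurable borel"
  shows "inverse_fourier F \<in> borel_measurable borel"
  unfolding inverse_fourier_def by (intro lborel.borel_measurable_lebesgue_integral) measurable

lemma inverse_fourier_bound:
  "cmod (inverse_fourier F x) \<le> (\<integral>\<xi>. cmod (F \<xi>) \<partial>lborel)"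
  unfolding inverse_fourier_def
  using integral_norm_bound[of lborel "\<lambda>\<xi>. F \<xi> * cis (2 * pi * \<xi> * x)"] by (simp add: norm_mult)

text \<open>After a dilation this is the characteristic function of the standard normal distribution.\<close>

lemma inverse_fourier_gaussian:
  assumes n: "0 < n"
  shows "inverse_fourier (\<lambda>\<xi>. complex_of_real (exp (- (\<xi> / n)\<^sup>2 / 2))) w = normal_density 0 (1 / (2 * pi * n)) w"
proof -
  have "inverse_fourier (\<lambda>\<xi>. complex_of_real (exp (- (\<xi> / n)\<^sup>2 / 2))) w
      = n *\<^sub>R (\<integral>z. complex_of_real (exp (- z\<^sup>2 / 2)) * cis (2 * pi * n * w * z) \<partial>lborel)"
  proof -
    have "inverse_fourier (\<lambda>\<xi>. complex_of_real (exp (- (\<xi> / n)\<^sup>2 / 2))) w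
        = \<bar>n\<bar> *\<^sub>R (\<integral>z. complex_of_real (exp (- ((0 + n * z) / n)\<^sup>2 / 2)) * cis (2 * pi * (0 + n * z) * w) \<partial>lborel)"
      unfolding inverse_fourier_def using n by (intro lborel_integral_real_affine) simp
    moreover have "complex_of_real (exp (- ((0 + n * z) / n)\<^sup>2 / 2)) * cis (2 * pi * (0 + n * z) * w)
        = complex_of_real (exp (- z\<^sup>2 / 2)) * cis (2 * pi * n * w * z)" for z
    proof -
      have "2 * pi * (0 + n * z) * w = 2 * pi * n * w * z" by simp
      moreover have "(0 + n * z) / n = z" using n by simp
      ultimately show ?thesis by (simp only:)
    qed
    ultimately show ?thesis using n by (simp only: abs_of_pos)
  qed
  also have "(\<integral>z. complex_of_real (exp (- z\<^sup>2 / 2)) * cis (2 * pi * n * w * z) \<partial>lborel)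
      = (\<integral>z. sqrt (2 * pi) *\<^sub>R (std_normal_density z *\<^sub>R cis (2 * pi * n * w * z)) \<partial>lborel)"
    by (intro Bochner_Integration.integral_cong refl)
      (simp add: std_normal_density_def scaleR_conv_of_real)
  also have "\<dots> = sqrt (2 * pi) *\<^sub>R (\<integral>z. std_normal_density z *\<^sub>R cis (2 * pi * n * w * z) \<partial>lborel)"
    by (rule integral_scaleR_right)
  also have "(\<integral>z. std_normal_density z *\<^sub>R cis (2 * pi * n * w * z) \<partial>lborel)
      = (\<integral>z. cis (2 * pi * n * w * z) \<partial>std_normal_distribution)"
    by (rule integral_density[symmetric]) (auto simp: normal_density_nonneg)
  also have "\<dots> = char std_normal_distribution (2 * pi * n * w)"
    unfolding char_def cis_conv_exp ..
  also have "\<dots> = exp (- (2 * pi * n * w)\<^sup>2 / 2)" by (simp add: char_std_normal_distribution)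
  also have "n *\<^sub>R (sqrt (2 * pi) *\<^sub>R complex_of_real (exp (- (2 * pi * n * w)\<^sup>2 / 2)))
      = complex_of_real (normal_density 0 (1 / (2 * pi * n)) w)"
  proof -
    define s where "s = sqrt (2 * pi)"
    have s: "0 < s" "2 * pi = s * s" by (auto simp: s_def)
    have "sqrt (2 * pi * (1 / (2 * pi * n))\<^sup>2) = s / (2 * pi * n)"
      using n by (simp add: s_def real_sqrt_mult real_sqrt_divide)
    also have "\<dots> = 1 / (n * s)"
      using n s(1) unfolding s(2) by (simp add: field_simps)
    finally have "1 / sqrt (2 * pi * (1 / (2 * pi * n))\<^sup>2) = n * s" by simp
    moreover have "(w - 0)\<^sup>2 / (2 * (1 / (2 * pi * n))\<^sup>2) = (2 * pi * n * w)\<^sup>2 / 2"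
      using n by (simp add: power_divide power_mult_distrib)
    ultimately have "normal_density 0 (1 / (2 * pi * n)) w = n * s * exp (- (2 * pi * n * w)\<^sup>2 / 2)"
      unfolding normal_density_def by (simp only: minus_divide_left[symmetric])
    then show ?thesis
      unfolding s_def by (simp only: scaleR_conv_of_real of_real_mult mult.assoc)
  qed
  finally show ?thesis .
qed

lemma normal_density_shift: "normal_density 0 \<sigma> (x - y) = normal_density x \<sigma> y"
  by (simp add: normal_density_def power2_commute)

text \<open>Multiplying the Fourier transform by a Gaussian convolves the function with the transformed Gaussian, a
  probability density that concentrates at \<open>0\<close> as \<open>n\<close> grows.\<close>

lemma gaussian_mean_inverse_fourier:
  assumes f'[measurable]: "f' \<in> borel_measurable borel" and int: "integrable lborel f'" and n: "0 < n"
  shows "inverse_fourier (\<lambda>\<xi>. (\<integral>y. f' y * cis (- 2 * pi * y * \<xi>) \<partial>lborel) * complex_of_real (exp (- (\<xi> / n)\<^sup>2 / 2))) x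
    = (\<integral>y. f' y * normal_density x (1 / (2 * pi * n)) y \<partial>lborel)"
proof -
  define g where "g \<xi> = complex_of_real (exp (- (\<xi> / n)\<^sup>2 / 2))" for \<xi>
  have [measurable]: "g \<in> borel_measurable borel" unfolding g_def by measurable
  have g: "integrable lborel g"
  proof -
    have "(\<lambda>\<xi>. exp (- (\<xi> / n)\<^sup>2 / 2)) = (\<lambda>\<xi>. (sqrt (2 * pi * n\<^sup>2)) * normal_density 0 n \<xi>)"
      using n by (auto simp: normal_density_def power_divide)
    then show ?thesis
      unfolding g_def using n by (intro integrable_of_real) simp
  qed
  have I: "integrable (lborel \<Otimes>\<^sub>M lborel)
      (\<lambda>(y, \<xi>). f' y * g \<xi> * (cis (- 2 * pi * y * \<xi>) * cis (2 * pi * \<xi> * x)))"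
    by (intro integrable_mult_bounded_kernel int g sigma_finite_lborel)
      (auto simp: norm_mult)
  have "inverse_fourier (\<lambda>\<xi>. (\<integral>y. f' y * cis (- 2 * pi * y * \<xi>) \<partial>lborel) * g \<xi>) x
      = (\<integral>\<xi>. (\<integral>y. f' y * g \<xi> * (cis (- 2 * pi * y * \<xi>) * cis (2 * pi * \<xi> * x)) \<partial>lborel) \<partial>lborel)"
    unfolding inverse_fourier_def
    by (simp add: integral_mult_left_zero[symmetric] integral_mult_right_zero[symmetric] mult_ac
        del: integral_mult_left_zero integral_mult_right_zero)
  also have "\<dots> = (\<integral>y. (\<integral>\<xi>. f' y * g \<xi> * (cis (- 2 * pi * y * \<xi>) * cis (2 * pi * \<xi> * x)) \<partial>lborel) \<partial>lborel)"
    by (rule lborel_pair.Fubini_integral[OF I])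
  also have "\<dots> = (\<integral>y. f' y * inverse_fourier g (x - y) \<partial>lborel)"
  proof (intro Bochner_Integration.integral_cong refl)
    fix y
    have "(\<integral>\<xi>. f' y * g \<xi> * (cis (- 2 * pi * y * \<xi>) * cis (2 * pi * \<xi> * x)) \<partial>lborel)
        = (\<integral>\<xi>. f' y * (g \<xi> * cis (2 * pi * \<xi> * (x - y))) \<partial>lborel)"
      by (intro Bochner_Integration.integral_cong refl) (simp add: cis_mult algebra_simps)
    then show "(\<integral>\<xi>. f' y * g \<xi> * (cis (- 2 * pi * y * \<xi>) * cis (2 * pi * \<xi> * x)) \<partial>lborel)
        = f' y * inverse_fourier g (x - y)"
      by (simp add: inverse_fourier_def)
  qed
  finally show ?thesis
    unfolding g_def inverse_fourier_gaussian[OF n] normal_density_shift .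
qed

text \<open>Averaging against a probability density does not increase the modular: Jensen's inequality pointwise,
  then Tonelli's theorem, using that the density is symmetric in \<open>x\<close> and \<open>y\<close> and so has mass one in either variable.\<close>

lemma young_integral_gaussian_mean:
  fixes f' :: "real \<Rightarrow> complex"
  assumes Y: "young_function \<Phi>" and f'[measurable]: "f' \<in> borel_measurable borel"
    and \<sigma>: "0 < \<sigma>" and l: "0 < l" "l < l'"
  shows "(\<integral>\<^sup>+x. \<Phi> (cmod (\<integral>y. f' y * normal_density x \<sigma> y \<partial>lborel) / l') \<partial>lborel)
    \<le> (\<integral>\<^sup>+y. \<Phi> (cmod (f' y) / l) \<partial>lborel)"
proof -
  note [measurable] = young_measurable[OF Y]
  have nd[measurable]: "(\<lambda>(x, y). normal_density x \<sigma> y) \<in> borel_measurable (borel \<Otimes>\<^sub>M borel)"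
    unfolding normal_density_def by measurable
  have mass: "(\<integral>\<^sup>+y. ennreal (normal_density x \<sigma> y) \<partial>lborel) = 1" for x
    using \<sigma> by (subst nn_integral_eq_integral) (auto simp: normal_density_nonneg)
  have sym: "normal_density x \<sigma> y = normal_density y \<sigma> x" for x y
    by (simp add: normal_density_def power2_commute)
  have pt: "\<Phi> (cmod (\<integral>y. f' y * normal_density x \<sigma> y \<partial>lborel) / l')
      \<le> (\<integral>\<^sup>+y. ennreal (normal_density x \<sigma> y) * \<Phi> (cmod (f' y) / l) \<partial>lborel)" for x
  proof -
    define J where "J = (\<integral>y. f' y * normal_density x \<sigma> y \<partial>lborel)"
    define \<rho> where "\<rho> = density lborel (\<lambda>y. ennreal (normal_density x \<sigma> y))"
    show ?thesis
    proof (cases "J = 0")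
      case True
      then show ?thesis unfolding J_def[symmetric] by (simp add: young_zero[OF Y])
    next
      case False
      have "ennreal 1 * \<Phi> (cmod J / l') \<le> (\<integral>\<^sup>+y. \<Phi> (cmod (f' y) / l) \<partial>\<rho>)"
      proof (rule young_jensen[OF Y])
        show "emeasure \<rho> (space \<rho>) \<le> ennreal 1"
          unfolding \<rho>_def by (subst emeasure_density) (auto simp: mass)
        have "ennreal (cmod J / l' * 1) < ennreal (cmod J / l)"
          using False l by (intro ennreal_lessI) (auto simp: field_simps)
        also have "\<dots> = ennreal (1 / l) * ennreal (cmod J)"
          using l by (simp add: ennreal_mult[symmetric])
        also have "\<dots> \<le> ennreal (1 / l) * (\<integral>\<^sup>+y. ennreal (cmod (f' y * normal_density x \<sigma> y)) \<partial>lborel)"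
          unfolding J_def by (intro mult_left_mono norm_integral_le_nn_integral) auto
        also have "\<dots> = (\<integral>\<^sup>+y. ennreal (1 / l) * ennreal (cmod (f' y * normal_density x \<sigma> y)) \<partial>lborel)"
          by (rule nn_integral_cmult[symmetric]) measurable
        also have "\<dots> = (\<integral>\<^sup>+y. ennreal (normal_density x \<sigma> y) * ennreal (cmod (f' y) / l) \<partial>lborel)"
          using l by (intro nn_integral_cong)
            (auto simp: norm_mult ennreal_mult[symmetric] normal_density_nonneg mult_ac)
        also have "\<dots> = (\<integral>\<^sup>+y. ennreal (cmod (f' y) / l) \<partial>\<rho>)"
          unfolding \<rho>_def by (rule nn_integral_density[symmetric]) measurable
        finally show "ennreal (cmod J / l' * 1) < (\<integral>\<^sup>+y. ennreal (cmod (f' y) / l) \<partial>\<rho>)" .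
      qed (use l in \<open>auto simp: \<rho>_def\<close>)
      also have "\<dots> = (\<integral>\<^sup>+y. ennreal (normal_density x \<sigma> y) * \<Phi> (cmod (f' y) / l) \<partial>lborel)"
        unfolding \<rho>_def by (rule nn_integral_density) measurable
      finally show ?thesis by (simp add: J_def)
    qed
  qed
  have "(\<integral>\<^sup>+x. \<Phi> (cmod (\<integral>y. f' y * normal_density x \<sigma> y \<partial>lborel) / l') \<partial>lborel)
      \<le> (\<integral>\<^sup>+x. (\<integral>\<^sup>+y. ennreal (normal_density x \<sigma> y) * \<Phi> (cmod (f' y) / l) \<partial>lborel) \<partial>lborel)"
    by (intro nn_integral_mono pt)
  also have "\<dots> = (\<integral>\<^sup>+y. (\<integral>\<^sup>+x. ennreal (normal_density x \<sigma> y) * \<Phi> (cmod (f' y) / l) \<partial>lborel) \<partial>lborel)"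
    by (rule lborel_pair.Fubini') measurable
  also have "\<dots> = (\<integral>\<^sup>+y. (\<integral>\<^sup>+x. ennreal (normal_density y \<sigma> x) \<partial>lborel) * \<Phi> (cmod (f' y) / l) \<partial>lborel)"
    by (subst sym, intro nn_integral_cong nn_integral_multc) measurable
  finally show ?thesis by (simp add: mass)
qed

text \<open>The substitute for lower semicontinuity: strictly below the limit only monotonicity is needed.\<close>

lemma young_le_liminf:
  assumes Y: "young_function \<Phi>" and lim: "z \<longlonglongrightarrow> w" and w: "0 \<le> v" "v < w \<or> v = 0"
  shows "\<Phi> v \<le> liminf (\<lambda>n. \<Phi> (z n))"
proof (cases "v = 0")
  case True
  then show ?thesis by (simp add: young_zero[OF Y])
next
  case False
  then have "eventually (\<lambda>n. v < z n) sequentially"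
    using w lim by (intro order_tendstoD) auto
  then show ?thesis
    by (intro Liminf_bounded) (auto elim!: eventually_mono intro!: young_mono[OF Y] w)
qed

text \<open>The Gaussian means \<open>h n\<close> of \<open>f\<close> satisfy the modular bound, and by dominated convergence (the Fourier
  transform of \<open>f\<close> is integrable) they converge everywhere to the function on the left.  Fatou's lemma
  then gives the bound for the limit.  The gap between \<open>l\<close> and \<open>l'\<close> is split at \<open>a\<close>: one half is used up by Jensen's inequality
  and the other by the passage to the limit.\<close>

lemma young_integral_inverse_fourier_le:
  assumes Y: "young_function \<Phi>" and f: "f \<in> band_limited"
    and l: "0 < l" "l < l'" and 1: "(\<integral>\<^sup>+x. \<Phi> (cmod (f x) / l) \<partial>lebesgue) \<le> 1"
  shows "(\<integral>\<^sup>+x. \<Phi> (cmod (inverse_fourier (fourier f) x) / l') \<partial>lborel) \<le> 1"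
proof -
  note [measurable] = young_measurable[OF Y]
  have fi: "integrable lebesgue f" using f by (simp add: band_limited_def)
  obtain f' where f'[measurable]: "f' \<in> borel_measurable borel"
    and int: "integrable lborel f'" and ae: "AE x in lebesgue. f x = f' x"
    using lebesgue_integrable_borel_representative[OF fi] by metis
  have F: "fourier f = (\<lambda>\<xi>. \<integral>x. f' x * cis (- 2 * pi * x * \<xi>) \<partial>lborel)"
    using fourier_eq_lborel[OF f' ae] fi by auto
  note [measurable] = band_limited_fourier_integrable(1)[OF f]
  note Fint = band_limited_fourier_integrable(2)[OF f]
  have f'1: "(\<integral>\<^sup>+x. \<Phi> (cmod (f' x) / l) \<partial>lborel) \<le> 1"
  proof -
    have "(\<integral>\<^sup>+x. \<Phi> (cmod (f' x) / l) \<partial>lborel) = (\<integral>\<^sup>+x. \<Phi> (cmod (f' x) / l) \<partial>lebesgue)"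
      by (rule nn_integral_completion[symmetric])
    also have "\<dots> = (\<integral>\<^sup>+x. \<Phi> (cmod (f x) / l) \<partial>lebesgue)"
      using ae by (intro nn_integral_cong_AE) auto
    finally show ?thesis using 1 by simp
  qed
  define a where "a = (l + l') / 2"
  have a: "l < a" "a < l'" using l by (auto simp: a_def)
  define h where "h n = inverse_fourier (\<lambda>\<xi>. fourier f \<xi> * complex_of_real (exp (- (\<xi> / real (Suc n))\<^sup>2 / 2)))" for n
  have [measurable]: "h n \<in> borel_measurable borel" for n
    unfolding h_def by measurable
  have h1: "(\<integral>\<^sup>+x. \<Phi> (cmod (h n x) / a) \<partial>lborel) \<le> 1" for n
  proof -
    have "h n = (\<lambda>x. \<integral>y. f' y * normal_density x (1 / (2 * pi * real (Suc n))) y \<partial>lborel)"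
      unfolding h_def F by (intro ext gaussian_mean_inverse_fourier f' int) simp
    then show ?thesis
      using young_integral_gaussian_mean[OF Y f', of "1 / (2 * pi * real (Suc n))" l a] l a f'1
      by (auto intro: order_trans)
  qed
  have lim: "(\<lambda>n. h n x) \<longlonglongrightarrow> inverse_fourier (fourier f) x" for x
    unfolding h_def inverse_fourier_def
  proof (rule integral_dominated_convergence[where w = "\<lambda>\<xi>. cmod (fourier f \<xi>)"])
    show "integrable lborel (\<lambda>\<xi>. cmod (fourier f \<xi>))" using Fint by simp
    show "AE \<xi> in lborel. (\<lambda>n. fourier f \<xi> * complex_of_real (exp (- (\<xi> / real (Suc n))\<^sup>2 / 2)) * cis (2 * pi * \<xi> * x))
        \<longlonglongrightarrow> fourier f \<xi> * cis (2 * pi * \<xi> * x)"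
    proof (rule AE_I2)
      fix \<xi> :: real
      have "(\<lambda>n. \<xi> / real (Suc n)) \<longlonglongrightarrow> 0"
        using LIMSEQ_Suc[OF lim_const_over_n[of \<xi>]] by simp
      then have "(\<lambda>n. exp (- (\<xi> / real (Suc n))\<^sup>2 / 2)) \<longlonglongrightarrow> exp (- 0\<^sup>2 / 2)"
        by (intro tendsto_intros) auto
      then have "(\<lambda>n. fourier f \<xi> * complex_of_real (exp (- (\<xi> / real (Suc n))\<^sup>2 / 2)) * cis (2 * pi * \<xi> * x))
          \<longlonglongrightarrow> fourier f \<xi> * complex_of_real (exp (- 0\<^sup>2 / 2)) * cis (2 * pi * \<xi> * x)"
        by (intro tendsto_mult tendsto_of_real tendsto_const)
      moreover have "fourier f \<xi> * complex_of_real (exp (- 0\<^sup>2 / 2)) * cis (2 * pi * \<xi> * x)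
          = fourier f \<xi> * cis (2 * pi * \<xi> * x)" by simp
      ultimately show "(\<lambda>n. fourier f \<xi> * complex_of_real (exp (- (\<xi> / real (Suc n))\<^sup>2 / 2)) * cis (2 * pi * \<xi> * x))
          \<longlonglongrightarrow> fourier f \<xi> * cis (2 * pi * \<xi> * x)" by (simp only:)
    qed
    show "AE \<xi> in lborel. cmod (fourier f \<xi> * complex_of_real (exp (- (\<xi> / real (Suc n))\<^sup>2 / 2)) * cis (2 * pi * \<xi> * x))
        \<le> cmod (fourier f \<xi>)" for n
    proof (rule AE_I2)
      fix \<xi> :: real
      have "cmod (fourier f \<xi>) * exp (- (\<xi> / real (Suc n))\<^sup>2 / 2) \<le> cmod (fourier f \<xi>) * 1"
        by (intro mult_left_mono) (auto simp del: of_nat_Suc)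
      then show "cmod (fourier f \<xi> * complex_of_real (exp (- (\<xi> / real (Suc n))\<^sup>2 / 2)) * cis (2 * pi * \<xi> * x))
          \<le> cmod (fourier f \<xi>)"
        by (simp add: norm_mult del: of_nat_Suc)
    qed
  qed measurable
  have "(\<integral>\<^sup>+x. \<Phi> (cmod (inverse_fourier (fourier f) x) / l') \<partial>lborel)
      \<le> (\<integral>\<^sup>+x. liminf (\<lambda>n. \<Phi> (cmod (h n x) / a)) \<partial>lborel)"
  proof (intro nn_integral_mono young_le_liminf[OF Y])
    fix x
    show "(\<lambda>n. cmod (h n x) / a) \<longlonglongrightarrow> cmod (inverse_fourier (fourier f) x) / a"
      using lim a l by (intro tendsto_intros) auto
    show "0 \<le> cmod (inverse_fourier (fourier f) x) / l'" using l by simp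
    show "cmod (inverse_fourier (fourier f) x) / l' < cmod (inverse_fourier (fourier f) x) / a
        \<or> cmod (inverse_fourier (fourier f) x) / l' = 0"
      using a l by (auto intro!: divide_strict_left_mono)
  qed
  also have "\<dots> \<le> liminf (\<lambda>n. \<integral>\<^sup>+x. \<Phi> (cmod (h n x) / a) \<partial>lborel)"
    by (intro nn_integral_liminf) measurable
  also have "\<dots> \<le> 1"
  proof (rule Liminf_le[THEN order_trans])
  qed (use h1 in auto)
  finally show ?thesis .
qed

section \<open>The bilinear operator as a superposition of translates\<close>

text \<open>Multiplying a Fourier transform by the exponential \<open>cis (- 2 * pi * t * (a * \<xi>))\<close> translates the
  function by \<open>a * t\<close>; integrate over \<open>t\<close>.\<close>

lemma integral_fourier_superposition:
  fixes F v :: "real \<Rightarrow> complex"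
  assumes \<rho>: "finite_measure \<rho>" and \<rho>_sets[measurable_cong]: "sets \<rho> = sets borel"
    and F: "integrable lborel F" and v: "integrable \<rho> v"
  shows "(\<integral>\<xi>. F \<xi> * (\<integral>t. v t * cis (- 2 * pi * t * (a * \<xi>)) \<partial>\<rho>) * cis (2 * pi * \<xi> * x) \<partial>lborel)
    = (\<integral>t. v t * inverse_fourier F (x - a * t) \<partial>\<rho>)"
proof -
  interpret finite_measure \<rho> by fact
  have sf: "sigma_finite_measure \<rho>" by (rule sigma_finite_measure_axioms)
  interpret pair_sigma_finite \<rho> lborel ..
  have I: "integrable (\<rho> \<Otimes>\<^sub>M lborel)
      (\<lambda>(t, \<xi>). v t * F \<xi> * (cis (- 2 * pi * t * (a * \<xi>)) * cis (2 * pi * \<xi> * x)))"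
    by (intro integrable_mult_bounded_kernel sigma_finite_lborel sf F v)
      (auto simp: norm_mult)
  have "(\<integral>\<xi>. F \<xi> * (\<integral>t. v t * cis (- 2 * pi * t * (a * \<xi>)) \<partial>\<rho>) * cis (2 * pi * \<xi> * x) \<partial>lborel)
      = (\<integral>\<xi>. (\<integral>t. v t * F \<xi> * (cis (- 2 * pi * t * (a * \<xi>)) * cis (2 * pi * \<xi> * x)) \<partial>\<rho>) \<partial>lborel)"
    by (simp add: integral_mult_left_zero[symmetric] integral_mult_right_zero[symmetric] mult_ac
        del: integral_mult_left_zero integral_mult_right_zero)
  also have "\<dots> = (\<integral>t. (\<integral>\<xi>. v t * F \<xi> * (cis (- 2 * pi * t * (a * \<xi>)) * cis (2 * pi * \<xi> * x)) \<partial>lborel) \<partial>\<rho>)"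
    by (rule Fubini_integral[OF I])
  also have "\<dots> = (\<integral>t. v t * inverse_fourier F (x - a * t) \<partial>\<rho>)"
  proof (intro Bochner_Integration.integral_cong refl)
    fix t
    have "(\<integral>\<xi>. v t * F \<xi> * (cis (- 2 * pi * t * (a * \<xi>)) * cis (2 * pi * \<xi> * x)) \<partial>lborel)
        = (\<integral>\<xi>. v t * (F \<xi> * cis (2 * pi * \<xi> * (x - a * t))) \<partial>lborel)"
      by (intro Bochner_Integration.integral_cong refl) (simp add: cis_mult algebra_simps)
    then show "(\<integral>\<xi>. v t * F \<xi> * (cis (- 2 * pi * t * (a * \<xi>)) * cis (2 * pi * \<xi> * x)) \<partial>lborel)
        = v t * inverse_fourier F (x - a * t)"
      by (simp add: inverse_fourier_def)
  qed
  finally show ?thesis .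
qed

lemma integrable_bounded_mult:
  fixes u w :: "real \<Rightarrow> complex"
  assumes "finite_measure \<rho>" "sets \<rho> = sets borel"
    and "u \<in> borel_measurable borel" "w \<in> borel_measurable borel"
    and "\<And>t. cmod (u t) \<le> 1" "\<And>t. cmod (w t) \<le> b"
  shows "integrable \<rho> (\<lambda>t. u t * w t)"
proof -
  interpret finite_measure \<rho> by fact
  note [measurable_cong] = assms(2)
  note [measurable] = assms(3,4)
  show ?thesis
  proof (rule integrable_const_bound[where B = b])
    show "(\<lambda>t. u t * w t) \<in> borel_measurable \<rho>" by measurable
    have "cmod (u t) * cmod (w t) \<le> 1 * b" for t
      using assms(5,6) by (intro mult_mono) auto
    then show "AE t in \<rho>. cmod (u t * w t) \<le> b" by (simp add: norm_mult)
  qed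
qed

text \<open>The previous lemma applied twice: first in \<open>\<xi>\<close>, with the exponential in \<open>\<eta>\<close> counted as part of the
  weight, then in \<open>\<eta>\<close>, with the translate already obtained as part of the weight.\<close>

lemma bilinear_op_superposition:
  fixes u :: "real \<Rightarrow> complex"
  assumes \<rho>: "finite_measure \<rho>" and \<rho>_sets[measurable_cong]: "sets \<rho> = sets borel"
    and u[measurable]: "u \<in> borel_measurable borel" and u1: "\<And>t. cmod (u t) \<le> 1"
    and m: "\<And>\<xi> \<eta>. m (\<xi>, \<eta>) = (\<integral>t. u t * cis (- 2 * pi * t * (\<alpha> * \<xi> + \<beta> * \<eta>)) \<partial>\<rho>)"
    and f: "f \<in> band_limited" and g: "g \<in> band_limited"
  shows "bilinear_op m f g x = (\<integral>t. u t *
    (inverse_fourier (fourier f) (x - \<alpha> * t) * inverse_fourier (fourier g) (x - \<beta> * t)) \<partial>\<rho>)"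
proof -
  interpret finite_measure \<rho> by fact
  define F where "F = fourier f"
  define G where "G = fourier g"
  have F[measurable]: "F \<in> borel_measurable borel" "integrable lborel F"
    unfolding F_def using band_limited_fourier_integrable[OF f] by auto
  have G[measurable]: "G \<in> borel_measurable borel" "integrable lborel G"
    unfolding G_def using band_limited_fourier_integrable[OF g] by auto
  define v where "v \<eta> t = u t * cis (- 2 * pi * t * (\<beta> * \<eta>))" for \<eta> t
  have v: "integrable \<rho> (v \<eta>)" for \<eta>
    unfolding v_def by (rule integrable_bounded_mult[OF \<rho> \<rho>_sets u _ u1, where b = 1]) auto
  have m_v: "m (\<xi>, \<eta>) = (\<integral>t. v \<eta> t * cis (- 2 * pi * t * (\<alpha> * \<xi>)) \<partial>\<rho>)" for \<xi> \<eta>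
    unfolding m v_def
  proof (intro Bochner_Integration.integral_cong refl)
    fix t
    have "- 2 * pi * t * (\<alpha> * \<xi> + \<beta> * \<eta>) = - 2 * pi * t * (\<beta> * \<eta>) + - 2 * pi * t * (\<alpha> * \<xi>)"
      by (simp add: algebra_simps)
    then show "u t * cis (- 2 * pi * t * (\<alpha> * \<xi> + \<beta> * \<eta>)) =
        u t * cis (- 2 * pi * t * (\<beta> * \<eta>)) * cis (- 2 * pi * t * (\<alpha> * \<xi>))"
      by (simp only: cis_mult[symmetric] mult.assoc)
  qed
  have m_meas[measurable]: "(\<lambda>\<xi>. m (\<xi>, \<eta>)) \<in> borel_measurable borel" for \<eta>
    unfolding m by (intro borel_measurable_lebesgue_integral) measurable
  have inner: "(LINT \<xi>|lebesgue. F \<xi> * G \<eta> * m (\<xi>, \<eta>) * cis (2 * pi * (\<xi> + \<eta>) * x))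
      = G \<eta> * (\<integral>t. u t * inverse_fourier F (x - \<alpha> * t) * cis (- 2 * pi * t * (\<beta> * \<eta>)) \<partial>\<rho>) * cis (2 * pi * \<eta> * x)" for \<eta>
  proof -
    have "(LINT \<xi>|lebesgue. F \<xi> * G \<eta> * m (\<xi>, \<eta>) * cis (2 * pi * (\<xi> + \<eta>) * x))
        = (LINT \<xi>|lborel. F \<xi> * G \<eta> * m (\<xi>, \<eta>) * cis (2 * pi * (\<xi> + \<eta>) * x))"
      by (rule integral_completion) measurable
    also have "\<dots> = (LINT \<xi>|lborel. (G \<eta> * cis (2 * pi * \<eta> * x)) *
        (F \<xi> * (\<integral>t. v \<eta> t * cis (- 2 * pi * t * (\<alpha> * \<xi>)) \<partial>\<rho>) * cis (2 * pi * \<xi> * x)))"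
    proof (intro Bochner_Integration.integral_cong refl)
      fix \<xi>
      have "cis (2 * pi * (\<xi> + \<eta>) * x) = cis (2 * pi * \<eta> * x) * cis (2 * pi * \<xi> * x)"
        by (simp add: cis_mult algebra_simps)
      then show "F \<xi> * G \<eta> * m (\<xi>, \<eta>) * cis (2 * pi * (\<xi> + \<eta>) * x) = (G \<eta> * cis (2 * pi * \<eta> * x)) *
        (F \<xi> * (\<integral>t. v \<eta> t * cis (- 2 * pi * t * (\<alpha> * \<xi>)) \<partial>\<rho>) * cis (2 * pi * \<xi> * x))"
        unfolding m_v by (simp only: mult_ac)
    qed
    also have "\<dots> = (G \<eta> * cis (2 * pi * \<eta> * x)) * (LINT \<xi>|lborel.
        F \<xi> * (\<integral>t. v \<eta> t * cis (- 2 * pi * t * (\<alpha> * \<xi>)) \<partial>\<rho>) * cis (2 * pi * \<xi> * x))"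
      by (rule integral_mult_right_zero)
    also have "\<dots> = (G \<eta> * cis (2 * pi * \<eta> * x)) * (\<integral>t. v \<eta> t * inverse_fourier F (x - \<alpha> * t) \<partial>\<rho>)"
      by (simp only: integral_fourier_superposition[OF \<rho> \<rho>_sets F(2) v])
    also have "\<dots> = G \<eta> * (\<integral>t. u t * inverse_fourier F (x - \<alpha> * t) * cis (- 2 * pi * t * (\<beta> * \<eta>)) \<partial>\<rho>) * cis (2 * pi * \<eta> * x)"
      by (simp only: v_def mult_ac)
    finally show ?thesis .
  qed
  have w: "integrable \<rho> (\<lambda>t. u t * inverse_fourier F (x - \<alpha> * t))"
    by (rule integrable_bounded_mult[OF \<rho> \<rho>_sets u _ u1 inverse_fourier_bound]) measurable
  have "bilinear_op m f g x = (LINT \<eta>|lebesgue.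
      G \<eta> * (\<integral>t. u t * inverse_fourier F (x - \<alpha> * t) * cis (- 2 * pi * t * (\<beta> * \<eta>)) \<partial>\<rho>) * cis (2 * pi * \<eta> * x))"
    unfolding bilinear_op_def F_def[symmetric] G_def[symmetric] inner ..
  also have "\<dots> = (LINT \<eta>|lborel.
      G \<eta> * (\<integral>t. u t * inverse_fourier F (x - \<alpha> * t) * cis (- 2 * pi * t * (\<beta> * \<eta>)) \<partial>\<rho>) * cis (2 * pi * \<eta> * x))"
    by (rule integral_completion) measurable
  also have "\<dots> = (\<integral>t. u t * inverse_fourier F (x - \<alpha> * t) * inverse_fourier G (x - \<beta> * t) \<partial>\<rho>)"
    by (rule integral_fourier_superposition[OF \<rho> \<rho>_sets G(2) w])
  finally show ?thesis unfolding F_def G_def by (simp only: mult.assoc)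
qed

section \<open>The norm estimate\<close>

lemma nn_integral_translation:
  fixes c :: real
  assumes [measurable]: "h \<in> borel_measurable borel"
  shows "(\<integral>\<^sup>+x. h (x - c) \<partial>lborel) = (\<integral>\<^sup>+x. h x \<partial>lborel)"
  using nn_integral_real_affine[of h 1 "- c"] by simp

text \<open>Jensen's inequality is applied to \<open>\<Phi>3\<close> at \<open>s = 2 * cmod (B x) / L\<close>, twice the argument in the claim.
  The product inequality bounds the result by \<open>R x\<close>, whose integral over \<open>x\<close> is at most two for
  each \<open>t\<close>, and \<open>\<Phi>3 (s / 2) \<le> \<Phi>3 s / 2\<close> turns the two into one.  The strict inequality between
  \<open>2 * V * (l1 * l2)\<close> and \<open>L\<close> leaves room for the factor \<open>\<theta>\<close> of the product inequality and for the strict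
  hypothesis of Jensen's inequality.\<close>

lemma young_integral_superposition:
  fixes p q :: "real \<Rightarrow> complex"
  assumes Y: "young_function \<Phi>1" "young_function \<Phi>2" "young_function \<Phi>3"
    and inv: "\<And>x::real. x \<ge> 0 \<Longrightarrow> young_inverse \<Phi>1 x * young_inverse \<Phi>2 x \<le> young_inverse \<Phi>3 x"
    and \<rho>: "finite_measure \<rho>" and \<rho>_sets[measurable_cong]: "sets \<rho> = sets borel"
    and V: "0 \<le> V" "emeasure \<rho> UNIV \<le> ennreal V"
    and pq[measurable]: "p \<in> borel_measurable borel" "q \<in> borel_measurable borel"
    and l: "0 < l1" "0 < l2" "2 * V * (l1 * l2) < L"
    and p1: "(\<integral>\<^sup>+x. \<Phi>1 (cmod (p x) / l1) \<partial>lborel) \<le> 1"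
    and q1: "(\<integral>\<^sup>+x. \<Phi>2 (cmod (q x) / l2) \<partial>lborel) \<le> 1"
    and B: "\<And>x. ennreal (cmod (B x)) \<le> (\<integral>\<^sup>+t. ennreal (cmod (p (x - \<alpha> * t)) * cmod (q (x - \<beta> * t))) \<partial>\<rho>)"
  shows "(\<integral>\<^sup>+x. \<Phi>3 (cmod (B x) / L) \<partial>lborel) \<le> 1"
proof (cases "V = 0")
  interpret finite_measure \<rho> by fact
  have space: "space \<rho> = UNIV" using sets_eq_imp_space_eq[OF \<rho>_sets] by simp
  case True
  then have "emeasure \<rho> (space \<rho>) = 0" using V space by simp
  then have "AE t in \<rho>. P t" for P by (intro AE_I[of _ _ "space \<rho>"]) auto
  then have "(\<integral>\<^sup>+t. h t \<partial>\<rho>) = (\<integral>\<^sup>+t. 0 \<partial>\<rho>)" for h by (rule nn_integral_cong_AE)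
  then have "B x = 0" for x using B[of x] by simp
  then show ?thesis by (simp add: young_zero[OF Y(3)])
next
  interpret finite_measure \<rho> by fact
  have space: "space \<rho> = UNIV" using sets_eq_imp_space_eq[OF \<rho>_sets] by simp
  note [measurable] = young_measurable[OF Y(1)] young_measurable[OF Y(2)] young_measurable[OF Y(3)]
  case False
  then have V0: "0 < V" using V by simp
  have L: "0 < L" using l V0 by (intro less_trans[OF _ l(3)]) auto
  obtain \<theta> where \<theta>: "2 * V * (l1 * l2) / L < \<theta>" "\<theta> < 1"
    using dense[of "2 * V * (l1 * l2) / L" 1] l L by auto
  have "0 < 2 * V * (l1 * l2) / L" using V0 l L by simp
  then have \<theta>0: "0 < \<theta>" using \<theta> by simp
  define R where "R x t = \<Phi>1 (cmod (p (x - \<alpha> * t)) / l1) + \<Phi>2 (cmod (q (x - \<beta> * t)) / l2)" for x t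
  have R[measurable]: "case_prod R \<in> borel_measurable (borel \<Otimes>\<^sub>M borel)"
    unfolding R_def by measurable
  have pt: "\<Phi>3 (cmod (B x) / L) \<le> ennreal (1 / (2 * V)) * (\<integral>\<^sup>+t. R x t \<partial>\<rho>)" for x
  proof (cases "B x = 0")
    case False
    define s where "s = 2 * (cmod (B x) / L)"
    define h where "h t = \<theta> * (cmod (p (x - \<alpha> * t)) / l1 * (cmod (q (x - \<beta> * t)) / l2))" for t
    have [measurable]: "h \<in> borel_measurable \<rho>" unfolding h_def by measurable
    have "s * V < \<theta> / (l1 * l2) * cmod (B x)"
    proof -
      have "2 * V / L < \<theta> / (l1 * l2)" using \<theta>(1) l L by (simp add: field_simps)
      then have "2 * V / L * cmod (B x) < \<theta> / (l1 * l2) * cmod (B x)"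
        using False by (intro mult_strict_right_mono) auto
      then show ?thesis by (simp add: s_def mult_ac)
    qed
    then have "ennreal (s * V) < ennreal (\<theta> / (l1 * l2)) * ennreal (cmod (B x))"
      using \<theta>0 l False by (subst ennreal_mult[symmetric]) (auto intro!: ennreal_lessI)
    also have "\<dots> \<le> ennreal (\<theta> / (l1 * l2)) *
        (\<integral>\<^sup>+t. ennreal (cmod (p (x - \<alpha> * t)) * cmod (q (x - \<beta> * t))) \<partial>\<rho>)"
      by (intro mult_left_mono B) auto
    also have "\<dots> = (\<integral>\<^sup>+t. ennreal (\<theta> / (l1 * l2)) * ennreal (cmod (p (x - \<alpha> * t)) * cmod (q (x - \<beta> * t))) \<partial>\<rho>)"
      by (rule nn_integral_cmult[symmetric]) measurable
    also have "\<dots> = (\<integral>\<^sup>+t. ennreal (h t) \<partial>\<rho>)"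
      using \<theta>0 l by (intro nn_integral_cong) (simp add: h_def ennreal_mult[symmetric] mult_ac)
    finally have less: "ennreal (s * V) < (\<integral>\<^sup>+t. ennreal (h t) \<partial>\<rho>)" .
    have "ennreal V * \<Phi>3 s \<le> (\<integral>\<^sup>+t. \<Phi>3 (h t) \<partial>\<rho>)"
      using V less L l \<theta>0 by (intro young_jensen[OF Y(3)]) (auto simp: space s_def h_def)
    also have "\<dots> \<le> (\<integral>\<^sup>+t. R x t \<partial>\<rho>)"
      unfolding h_def R_def using l \<theta> \<theta>0 by (intro nn_integral_mono young_product[OF Y inv]) auto
    finally have J: "ennreal V * \<Phi>3 s \<le> (\<integral>\<^sup>+t. R x t \<partial>\<rho>)" .
    have "\<Phi>3 (cmod (B x) / L) \<le> ennreal (1 / 2) * \<Phi>3 s"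
      using young_scale[OF Y(3), of "1 / 2" s] by (simp add: s_def)
    also have "\<dots> = ennreal (1 / (2 * V)) * (ennreal V * \<Phi>3 s)"
      using V0 by (simp add: mult.assoc[symmetric] ennreal_mult[symmetric])
    also have "\<dots> \<le> ennreal (1 / (2 * V)) * (\<integral>\<^sup>+t. R x t \<partial>\<rho>)"
      by (intro mult_left_mono J) auto
    finally show ?thesis .
  qed (simp add: young_zero[OF Y(3)])
  interpret pair_sigma_finite lborel \<rho> ..
  have Rx: "(\<integral>\<^sup>+x. R x t \<partial>lborel) \<le> 2" for t
  proof -
    have "(\<integral>\<^sup>+x. R x t \<partial>lborel) = (\<integral>\<^sup>+x. \<Phi>1 (cmod (p (x - \<alpha> * t)) / l1) \<partial>lborel)
        + (\<integral>\<^sup>+x. \<Phi>2 (cmod (q (x - \<beta> * t)) / l2) \<partial>lborel)"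
      unfolding R_def by (rule nn_integral_add) measurable
    also have "\<dots> = (\<integral>\<^sup>+x. \<Phi>1 (cmod (p x) / l1) \<partial>lborel) + (\<integral>\<^sup>+x. \<Phi>2 (cmod (q x) / l2) \<partial>lborel)"
      using nn_integral_translation[of "\<lambda>x. \<Phi>1 (cmod (p x) / l1)" "\<alpha> * t"]
        nn_integral_translation[of "\<lambda>x. \<Phi>2 (cmod (q x) / l2)" "\<beta> * t"] by simp
    also have "\<dots> \<le> 1 + 1" by (intro add_mono p1 q1)
    finally show ?thesis by simp
  qed
  have "(\<integral>\<^sup>+x. \<Phi>3 (cmod (B x) / L) \<partial>lborel)
      \<le> (\<integral>\<^sup>+x. ennreal (1 / (2 * V)) * (\<integral>\<^sup>+t. R x t \<partial>\<rho>) \<partial>lborel)"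
    by (intro nn_integral_mono pt)
  also have "\<dots> = ennreal (1 / (2 * V)) * (\<integral>\<^sup>+x. (\<integral>\<^sup>+t. R x t \<partial>\<rho>) \<partial>lborel)"
    by (rule nn_integral_cmult) measurable
  also have "(\<integral>\<^sup>+x. (\<integral>\<^sup>+t. R x t \<partial>\<rho>) \<partial>lborel) = (\<integral>\<^sup>+t. (\<integral>\<^sup>+x. R x t \<partial>lborel) \<partial>\<rho>)"
    by (rule Fubini'[symmetric]) measurable
  also have "\<dots> \<le> (\<integral>\<^sup>+t. 2 \<partial>\<rho>)" by (intro nn_integral_mono Rx)
  also have "\<dots> \<le> 2 * ennreal V" using V by (simp add: space mult_left_mono)
  also have "ennreal (1 / (2 * V)) * (2 * ennreal V) = 1"
    using V0 by (simp add: ennreal_mult[symmetric] ennreal_numeral[symmetric] del: ennreal_numeral)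
  finally show ?thesis by (simp add: mult_left_mono)
qed

lemma luxemburg_norm_zero:
  assumes "young_function \<Phi>"
  shows "luxemburg_norm \<Phi> (\<lambda>_. 0) = 0"
  using luxemburg_norm_leI[of 0 \<Phi> "\<lambda>_. 0"] by (simp add: young_zero[OF assms])

lemma ennreal_le_mult_Inf:
  fixes X c :: ennreal
  assumes c: "c \<noteq> 0" "c < top" and le: "\<And>a. a \<in> A \<Longrightarrow> X \<le> c * a"
  shows "X \<le> c * Inf A"
proof -
  have "X / c \<le> Inf A"
    using le c by (intro Inf_greatest divide_le_posI_ennreal) (auto simp: zero_less_iff_neq_zero)
  then have "X / c * c \<le> Inf A * c" by (rule mult_right_mono) simp
  moreover have "X / c * c = X" by (simp only: ennreal_divide_times ennreal_divide_self[OF c] mult_1_right)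
  ultimately show ?thesis by (simp only: mult.commute)
qed

text \<open>Passage to the infimum in both norms.  Multiplication in \<open>ennreal\<close> is not continuous at \<open>(0, \<infinity>)\<close>, so
  vanishing infima have to be excluded.\<close>

lemma ennreal_le_mult_Inf_Inf:
  fixes X c :: ennreal
  assumes c: "c \<noteq> 0" "c < top" and le: "\<And>a b. a \<in> A \<Longrightarrow> b \<in> B \<Longrightarrow> X \<le> c * a * b"
    and fin: "\<And>b. b \<in> B \<Longrightarrow> b < top"
    and ne: "Inf A \<noteq> 0" "Inf B \<noteq> 0"
  shows "X \<le> c * Inf A * Inf B"
proof (cases "Inf A = top")
  case True
  show ?thesis unfolding True using c ne(2) by (simp add: ennreal_mult_top ennreal_top_mult)
next
  case False
  have *: "X \<le> c * Inf A * b" if b: "b \<in> B" for b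
  proof -
    have "b \<noteq> 0" using b ne(2) Inf_lower[OF b] by auto
    then have "X \<le> (c * b) * Inf A"
      using le b c fin[OF b]
      by (intro ennreal_le_mult_Inf) (auto simp: ennreal_mult_less_top mult_ac)
    then show ?thesis by (simp only: mult_ac)
  qed
  show ?thesis
  proof (rule ennreal_le_mult_Inf)
    show "c * Inf A \<noteq> 0" using c ne by simp
    have "Inf A < top" using False by (simp only: less_top)
    then show "c * Inf A < top" using c unfolding ennreal_mult_less_top by blast
  qed (rule *)
qed

text \<open>The strict inequality \<open>2 * V < C\<close> pays for enlarging the admissible \<open>l1\<close> and \<open>l2\<close> by a factor \<open>c > 1\<close>
  when \<open>f\<close> and \<open>g\<close> are replaced by their Fourier inversions.\<close>

lemma bm_bound_superposition:
  fixes u :: "real \<Rightarrow> complex"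
  assumes Y: "young_function \<Phi>1" "young_function \<Phi>2" "young_function \<Phi>3"
    and inv: "\<And>x::real. x \<ge> 0 \<Longrightarrow> young_inverse \<Phi>1 x * young_inverse \<Phi>2 x \<le> young_inverse \<Phi>3 x"
    and \<rho>: "finite_measure \<rho>" "sets \<rho> = sets borel"
    and V: "0 \<le> V" "emeasure \<rho> UNIV \<le> ennreal V"
    and u: "u \<in> borel_measurable borel" "\<And>t. cmod (u t) \<le> 1"
    and m: "\<And>\<xi> \<eta>. m (\<xi>, \<eta>) = (\<integral>t. u t * cis (- 2 * pi * t * (\<alpha> * \<xi> + \<beta> * \<eta>)) \<partial>\<rho>)"
    and C: "2 * V < C"
  shows "bm_bound \<Phi>1 \<Phi>2 \<Phi>3 m C"
  unfolding bm_bound_def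
proof (intro ballI)
  fix f g assume f: "f \<in> band_limited" and g: "g \<in> band_limited"
  have fm: "f \<in> borel_measurable lebesgue" "g \<in> borel_measurable lebesgue"
    using f g by (auto simp: band_limited_def)
  let ?B = "bilinear_op m f g"
  have zero: "luxemburg_norm \<Phi>3 ?B = 0"
    if "luxemburg_norm \<Phi>1 f = 0 \<or> luxemburg_norm \<Phi>2 g = 0"
  proof -
    have "(\<forall>\<xi>. fourier f \<xi> = 0) \<or> (\<forall>\<xi>. fourier g \<xi> = 0)"
      using that fm luxemburg_norm_zero_imp_AE[OF Y(1), of f] luxemburg_norm_zero_imp_AE[OF Y(2), of g]
        fourier_AE_zero by metis
    then have "?B = (\<lambda>_. 0)" by (auto simp: bilinear_op_def)
    then show ?thesis by (simp add: luxemburg_norm_zero[OF Y(3)])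
  qed
  define P where "P = inverse_fourier (fourier f)"
  define Q where "Q = inverse_fourier (fourier g)"
  have [measurable]: "P \<in> borel_measurable borel" "Q \<in> borel_measurable borel"
    unfolding P_def Q_def using band_limited_fourier_integrable[OF f] band_limited_fourier_integrable[OF g] by auto
  have B: "ennreal (cmod (?B x)) \<le> (\<integral>\<^sup>+t. ennreal (cmod (P (x - \<alpha> * t)) * cmod (Q (x - \<beta> * t))) \<partial>\<rho>)" for x
  proof -
    have "ennreal (cmod (?B x)) \<le> (\<integral>\<^sup>+t. ennreal (cmod (u t * (P (x - \<alpha> * t) * Q (x - \<beta> * t)))) \<partial>\<rho>)"
      unfolding bilinear_op_superposition[OF \<rho> u m f g] P_def Q_def by (rule norm_integral_le_nn_integral)
    also have "\<dots> \<le> (\<integral>\<^sup>+t. ennreal (cmod (P (x - \<alpha> * t)) * cmod (Q (x - \<beta> * t))) \<partial>\<rho>)"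
      using u(2) by (intro nn_integral_mono ennreal_leI) (auto simp: norm_mult intro!: mult_left_le_one_le)
    finally show ?thesis .
  qed
  have adm: "luxemburg_norm \<Phi>3 ?B \<le> ennreal (C * (l1 * l2))"
    if l1: "0 < l1" "(\<integral>\<^sup>+ x. \<Phi>1 (cmod (f x) / l1) \<partial>lebesgue) \<le> 1"
    and l2: "0 < l2" "(\<integral>\<^sup>+ x. \<Phi>2 (cmod (g x) / l2) \<partial>lebesgue) \<le> 1" for l1 l2
  proof (rule luxemburg_norm_leI)
    show "0 \<le> C * (l1 * l2)" using C V l1 l2 by simp
    fix L assume L: "C * (l1 * l2) < L"
    \<comment> \<open>Chosen so that \<open>1 < c\<close> and \<open>c\<^sup>2 * (2 * V) \<le> C\<close>, also when \<open>V = 0\<close>.\<close>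
    define c where "c = sqrt ((C + 1) / (2 * V + 1))"
    have c1: "1 < c" using C V by (simp add: c_def)
    have "c\<^sup>2 * (2 * V) \<le> C"
      using C V by (simp add: c_def field_simps)
    then have "c\<^sup>2 * (2 * V) * (l1 * l2) \<le> C * (l1 * l2)" using l1 l2 by (intro mult_right_mono) auto
    then have cL: "2 * V * (c * l1 * (c * l2)) < L" using L by (simp add: power2_eq_square mult_ac)
    have "(\<integral>\<^sup>+x. \<Phi>1 (cmod (P x) / (c * l1)) \<partial>lborel) \<le> 1"
      unfolding P_def using c1 by (intro young_integral_inverse_fourier_le[OF Y(1) f l1(1) _ l1(2)]) (simp add: l1(1))
    moreover have "(\<integral>\<^sup>+x. \<Phi>2 (cmod (Q x) / (c * l2)) \<partial>lborel) \<le> 1"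
      unfolding Q_def using c1 by (intro young_integral_inverse_fourier_le[OF Y(2) g l2(1) _ l2(2)]) (simp add: l2(1))
    ultimately have "(\<integral>\<^sup>+x. \<Phi>3 (cmod (?B x) / L) \<partial>lborel) \<le> 1"
      using c1 l1(1) l2(1) by (intro young_integral_superposition[OF Y inv \<rho> V _ _ _ _ cL _ _ B]) auto
    then show "(\<integral>\<^sup>+x. \<Phi>3 (cmod (?B x) / L) \<partial>lebesgue) \<le> 1"
      by (simp add: nn_integral_completion)
  qed
  show "luxemburg_norm \<Phi>3 ?B \<le> ennreal C * luxemburg_norm \<Phi>1 f * luxemburg_norm \<Phi>2 g"
  proof (cases "luxemburg_norm \<Phi>1 f = 0 \<or> luxemburg_norm \<Phi>2 g = 0")
    case True
    then show ?thesis using zero by simp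
  next
    case False
    have "0 < C" using C V by simp
    show ?thesis
      unfolding luxemburg_norm_def[of \<Phi>1] luxemburg_norm_def[of \<Phi>2]
    proof (rule ennreal_le_mult_Inf_Inf, goal_cases)
      case (3 a b)
      then obtain l1 l2 where l: "a = ennreal l1" "0 < l1" "(\<integral>\<^sup>+ x. \<Phi>1 (cmod (f x) / l1) \<partial>lebesgue) \<le> 1"
        "b = ennreal l2" "0 < l2" "(\<integral>\<^sup>+ x. \<Phi>2 (cmod (g x) / l2) \<partial>lebesgue) \<le> 1" by blast
      then show ?case using adm[of l1 l2] \<open>0 < C\<close> by (simp add: ennreal_mult mult.assoc)
    qed (use False \<open>0 < C\<close> in \<open>auto simp: luxemburg_norm_def\<close>)
  qed
qed

lemma absolutely_integrable_on_compact_bounded: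
  fixes m :: "real \<times> real \<Rightarrow> complex"
  assumes m: "m \<in> borel_measurable borel" and b: "\<And>p. cmod (m p) \<le> b" and K: "compact K"
  shows "m absolutely_integrable_on K"
  unfolding set_integrable_def
proof (rule integrableI_bounded_set[where A = K and B = b])
  have [measurable]: "K \<in> sets borel" using K by (simp add: borel_compact)
  show "K \<in> sets lebesgue" by simp
  show "(\<lambda>x. indicator K x *\<^sub>R m x) \<in> borel_measurable lebesgue"
    using m by (intro measurable_completion) measurable
  show "emeasure lebesgue K < \<infinity>"
    using emeasure_bounded_finite[OF compact_imp_bounded[OF K]] by simp
qed (use b in \<open>auto split: split_indicator\<close>)

theorem proposition3p4:
  fixes \<Phi>1 \<Phi>2 \<Phi>3 :: "real \<Rightarrow> ennreal"
    and \<alpha> \<beta> :: real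
    and \<mu> :: "real set \<Rightarrow> complex"
    and m :: "real \<times> real \<Rightarrow> complex"
  assumes "young_function \<Phi>1" "young_function \<Phi>2" "young_function \<Phi>3"
    and "\<And>x::real. x \<ge> 0 \<Longrightarrow>
           young_inverse \<Phi>1 x * young_inverse \<Phi>2 x \<le> young_inverse \<Phi>3 x"
    and "finite_regular_borel_measure \<mu>"
    and "\<And>\<xi> \<eta>. m (\<xi>, \<eta>) = fourier_measure \<mu> (\<alpha> * \<xi> + \<beta> * \<eta>)"
  shows "m \<in> BM \<Phi>1 \<Phi>2 \<Phi>3 \<and> bm_norm \<Phi>1 \<Phi>2 \<Phi>3 m \<le> 2 * variation \<mu> UNIV"
proof -
  have \<mu>: "complex_measure \<mu>" "variation \<mu> UNIV < \<infinity>"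
    using assms(5) by (auto simp: finite_regular_borel_measure_def)
  obtain \<rho> u where \<rho>: "finite_measure \<rho>" and \<rho>_sets[measurable_cong]: "sets \<rho> = sets borel"
    and tot: "emeasure \<rho> UNIV \<le> variation \<mu> UNIV"
    and u[measurable]: "u \<in> borel_measurable borel" and u1: "\<And>x. cmod (u x) \<le> 1"
    and int: "\<And>f. f \<in> borel_measurable borel \<Longrightarrow> bounded (range f) \<Longrightarrow>
       complex_measure_integral \<mu> f = (\<integral>x. u x * f x \<partial>\<rho>)"
    by (rule complex_measure_polar[OF \<mu>]) (rule that, auto)
  interpret finite_measure \<rho> by fact
  have space: "space \<rho> = UNIV" using sets_eq_imp_space_eq[OF \<rho>_sets] by simp
  have m: "m (\<xi>, \<eta>) = (\<integral>t. u t * cis (- 2 * pi * t * (\<alpha> * \<xi> + \<beta> * \<eta>)) \<partial>\<rho>)" for \<xi> \<eta>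
    unfolding assms(6) fourier_measure_def by (rule int) (auto simp: bounded_iff intro: exI[of _ 1])
  define V where "V = enn2real (variation \<mu> UNIV)"
  have V: "0 \<le> V" "variation \<mu> UNIV = ennreal V" using \<mu>(2) by (auto simp: V_def)
  have bound: "bm_bound \<Phi>1 \<Phi>2 \<Phi>3 m C" if "2 * V < C" for C
    using bm_bound_superposition[OF assms(1-4) \<rho> \<rho>_sets V(1) _ u u1 m that] tot V by simp
  have m_eq: "m = (\<lambda>p. \<integral>t. u t * cis (- 2 * pi * t * (\<alpha> * fst p + \<beta> * snd p)) \<partial>\<rho>)"
    by (auto simp: m)
  have "m \<in> borel_measurable borel"
    unfolding m_eq borel_prod[symmetric] by (intro borel_measurable_lebesgue_integral) measurable
  moreover have "cmod (m p) \<le> measure \<rho> UNIV" for p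
  proof -
    have "cmod (m p) \<le> (\<integral>t. 1 \<partial>\<rho>)"
      unfolding m_eq
    proof (rule Bochner_Integration.integral_norm_bound_integral)
      show "integrable \<rho> (\<lambda>t. u t * cis (- 2 * pi * t * (\<alpha> * fst p + \<beta> * snd p)))"
        by (rule integrable_bounded_mult[OF \<rho> \<rho>_sets u _ u1, where b = 1]) auto
    qed (use u1 in \<open>auto simp: norm_mult\<close>)
    then show ?thesis by (simp add: space)
  qed
  ultimately have "\<forall>K. compact K \<longrightarrow> m absolutely_integrable_on K"
    using absolutely_integrable_on_compact_bounded by blast
  moreover have "\<exists>C>0. bm_bound \<Phi>1 \<Phi>2 \<Phi>3 m C"
    using bound[of "2 * V + 1"] V by (intro exI[of _ "2 * V + 1"]) auto
  ultimately have "m \<in> BM \<Phi>1 \<Phi>2 \<Phi>3" by (simp add: BM_def)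
  moreover have "bm_norm \<Phi>1 \<Phi>2 \<Phi>3 m \<le> ennreal (2 * V)"
  proof (rule ennreal_le_epsilon)
    fix e :: real assume "0 < e"
    then have "bm_norm \<Phi>1 \<Phi>2 \<Phi>3 m \<le> ennreal (2 * V + e)"
      unfolding bm_norm_def using bound[of "2 * V + e"] V
      by (intro Inf_lower CollectI exI[of _ "2 * V + e"]) auto
    then show "bm_norm \<Phi>1 \<Phi>2 \<Phi>3 m \<le> ennreal (2 * V) + ennreal e"
      using V \<open>0 < e\<close> by simp
  qed
  then have "bm_norm \<Phi>1 \<Phi>2 \<Phi>3 m \<le> 2 * variation \<mu> UNIV"
    using V by (simp add: ennreal_mult)
  ultimately show ?thesis ..
qed

end
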